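(* Let $K$ be a field, $\sigma$ an automorphism of $K$ of finite order $n>1$ with fixed field $F=\mathrm{Fix}(\sigma)$, and $R=K[t;\sigma]$. Let $f\in F[t]\subset R$ be monic of degree $m\geq 2$, bounded and not right invariant, with $\mathrm{gcrd}(f,t)=1$, and let $h(t)=\hat h(t^n)$, $\hat h(x)\in F[x]$ monic, be the minimal central left multiple of $f$ in $R$. Let $l$ be the number of irreducible factors of $f$ in $R$ and $k$ the number of irreducible factors of $h$ in $R$. Write $N=\mathrm{Nuc}(S_f)$. (i) If $\hat h(x)$ is irreducible in $F[x]$ and $[N:F]=ln/k$, then $\mathrm{Nuc}_r(S_f)=N[t;\sigma]/N[t;\sigma]f$. (ii) If $[N:F]>\frac{nl}{k}$, then $\hat h(x)$ is reducible in $F[x]$, and therefore $f$ is reducible in $R$ as well.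
   Context: $R=K[t;\sigma]$ is the twisted polynomial ring: polynomials $\sum b_it^i$ with $b_i\in K$, termwise addition, and multiplication determined by $ta=\sigma(a)t$ for $a\in K$. Since $\sigma$ has order $n$, $R$ has center $F[t^n]\cong F[x]$, $x=t^n$. $\mathrm{gcrd}$ is the greatest common right divisor in $R$. $f$ is right invariant if $Rf$ is a two-sided ideal; $f$ is bounded if there is a nonzero $f^*\in R$ such that $Rf^*$ is the largest two-sided ideal of $R$ contained in $Rf$. The minimal central left multiple of $f$ is the unique polynomial $h\in F[t^n]$ of minimal degree such that $h=gf$ for some $g\in R$ and $h(t)=\hat h(t^n)$ with $\hat h\in F[x]$ monic. Numbers of irreducible factors refer to the number of factors, counted with repetition, in a factorization into irreducible elements of $R$. The Petit algebra $S_f$ is the unital nonassociative $F$-algebra with underlying additive group $\{g\in R:\deg g<m\}$ and multiplication $g\circ h=gh\,\mathrm{mod}_r f$, the remainder of $gh$ under right division by $f$. Left, middle and right nucleus are $\mathrm{Nuc}_l(S_f)=\{x:(xy)z=x(yz)\ \forall y,z\}$, $\mathrm{Nuc}_m(S_f)=\{x:(yx)z=y(xz)\ \forall y,z\}$, $\mathrm{Nuc}_r(S_f)=\{x:(yz)x=y(zx)\ \forall y,z\}$, and $\mathrm{Nuc}(S_f)$ is their intersection, a $\sigma$-stable subfield of $K$ containing $F$ when $f$ is not right invariant. $N[t;\sigma]/N[t;\sigma]f$ is the Petit algebra formed in the same way from $N[t;\sigma|_N]$ and $f$ (polynomials of degree $<m$ with coefficients in $N$), viewed as a subset of $S_f$.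 *)

theory Defs
  imports
    "HOL-Algebra.Algebra"
    "HOL-Algebra.Algebraic_Closure_Type"
    "HOL-Computational_Algebra.Polynomial"
begin

text \<open>The type \<^typ>\<open>'a poly\<close> supplies the additive group. The product extends
  \<open>(a t^i) (b t^j) = a \<sigma>^i(b) t^(i + j)\<close> additively, which is what \<open>t a = \<sigma>(a) t\<close> forces.\<close>

definition skew_mult :: "('a::field \<Rightarrow> 'a) \<Rightarrow> 'a poly \<Rightarrow> 'a poly \<Rightarrow> 'a poly" where
  "skew_mult \<sigma> p q =
     (\<Sum>i\<le>degree p. \<Sum>j\<le>degree q. monom (coeff p i * (\<sigma> ^^ i) (coeff q j)) (i + j))"

text \<open>\<open>skew_poly_ring L \<sigma>\<close> is \<open>L[t;\<sigma>]\<close> for a subfield \<open>L\<close> with \<open>\<sigma>(L) \<subseteq> L\<close>; with \<open>L = UNIV\<close>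
  it is \<open>K[t;\<sigma>]\<close>. \<open>poly_ring_over L\<close> is the commutative ring \<open>L[x]\<close>.\<close>

definition polys_over :: "'a::field set \<Rightarrow> 'a poly set" where
  "polys_over L = {p. range (coeff p) \<subseteq> L}"

definition skew_poly_ring :: "'a::field set \<Rightarrow> ('a \<Rightarrow> 'a) \<Rightarrow> 'a poly ring" where
  "skew_poly_ring L \<sigma> =
     \<lparr>carrier = polys_over L, monoid.mult = skew_mult \<sigma>, one = 1, ring.zero = 0, add = (+)\<rparr>"

definition poly_ring_over :: "'a::field set \<Rightarrow> 'a poly ring" where
  "poly_ring_over L =
     \<lparr>carrier = polys_over L, monoid.mult = (*), one = 1, ring.zero = 0, add = (+)\<rparr>"

definition fixed_field :: "('a \<Rightarrow> 'a) \<Rightarrow> 'a set" where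
  "fixed_field \<sigma> = {a. \<sigma> a = a}"

definition has_order :: "('a \<Rightarrow> 'a) \<Rightarrow> nat \<Rightarrow> bool" where
  "has_order \<sigma> n \<longleftrightarrow> 0 < n \<and> \<sigma> ^^ n = id \<and> (\<forall>j. 0 < j \<and> j < n \<longrightarrow> \<sigma> ^^ j \<noteq> id)"

definition right_divides :: "('b, 'c) monoid_scheme \<Rightarrow> 'b \<Rightarrow> 'b \<Rightarrow> bool" where
  "right_divides A d p \<longleftrightarrow> (\<exists>g \<in> carrier A. p = g \<otimes>\<^bsub>A\<^esub> d)"

definition left_ideal_of :: "('b, 'c) monoid_scheme \<Rightarrow> 'b \<Rightarrow> 'b set" where
  "left_ideal_of A f = {g \<otimes>\<^bsub>A\<^esub> f | g. g \<in> carrier A}"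

definition right_invariant :: "('b, 'c) ring_scheme \<Rightarrow> 'b \<Rightarrow> bool" where
  "right_invariant A f \<longleftrightarrow> ideal (left_ideal_of A f) A"

definition bounded_elem :: "('b, 'c) ring_scheme \<Rightarrow> 'b \<Rightarrow> bool" where
  "bounded_elem A f \<longleftrightarrow>
     (\<exists>b \<in> carrier A. b \<noteq> \<zero>\<^bsub>A\<^esub> \<and> ideal (left_ideal_of A b) A \<and>
        left_ideal_of A b \<subseteq> left_ideal_of A f \<and>
        (\<forall>I. ideal I A \<and> I \<subseteq> left_ideal_of A f \<longrightarrow> I \<subseteq> left_ideal_of A b))"

text \<open>The library's \<^const>\<open>irreducible\<close> is phrased through divisibility on one side only, so
  irreducibility is stated here directly in terms of products.\<close>

definition irreducible_elem :: "('b, 'c) ring_scheme \<Rightarrow> 'b \<Rightarrow> bool" where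
  "irreducible_elem A p \<longleftrightarrow>
     p \<in> carrier A \<and> p \<noteq> \<zero>\<^bsub>A\<^esub> \<and> p \<notin> Units A \<and>
     (\<forall>a \<in> carrier A. \<forall>b \<in> carrier A. p = a \<otimes>\<^bsub>A\<^esub> b \<longrightarrow> a \<in> Units A \<or> b \<in> Units A)"

definition reducible_elem :: "('b, 'c) ring_scheme \<Rightarrow> 'b \<Rightarrow> bool" where
  "reducible_elem A p \<longleftrightarrow>
     p \<in> carrier A \<and> p \<noteq> \<zero>\<^bsub>A\<^esub> \<and> p \<notin> Units A \<and> \<not> irreducible_elem A p"

text \<open>A relation rather than a function of \<open>p\<close>: it says that \<open>p\<close> is a product of \<open>l\<close>
  irreducible elements. In \<open>K[t;\<sigma>]\<close> the number \<open>l\<close> does not depend on the factorization.\<close>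

definition num_irreducible_factors :: "('b, 'c) ring_scheme \<Rightarrow> 'b \<Rightarrow> nat \<Rightarrow> bool" where
  "num_irreducible_factors A p l \<longleftrightarrow>
     (\<exists>gs. length gs = l \<and> (\<forall>g \<in> set gs. irreducible_elem A g) \<and>
           foldr (\<lambda>a b. a \<otimes>\<^bsub>A\<^esub> b) gs \<one>\<^bsub>A\<^esub> = p)"

definition is_gcrd :: "('a::field \<Rightarrow> 'a) \<Rightarrow> 'a poly \<Rightarrow> 'a poly \<Rightarrow> 'a poly \<Rightarrow> bool" where
  "is_gcrd \<sigma> d f g \<longleftrightarrow>
     (let R = skew_poly_ring UNIV \<sigma> in
        lead_coeff d = 1 \<and> right_divides R d f \<and> right_divides R d g \<and>
        (\<forall>e. right_divides R e f \<and> right_divides R e g \<longrightarrow> right_divides R e d))"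

text \<open>Since \<open>t^i t^j = t^(i + j)\<close> also in \<open>K[t;\<sigma>]\<close>, ordinary composition with \<open>t^n\<close> computes
  the value of a polynomial at \<open>t^n\<close>.\<close>

definition subst_tn :: "nat \<Rightarrow> 'a::field poly \<Rightarrow> 'a poly" where
  "subst_tn n p = pcompose p (monom 1 n)"

text \<open>\<open>is_min_central_left_multiple \<sigma> n f hh\<close> says that \<open>h(t) = hh(t^n)\<close> is the minimal central
  left multiple of \<open>f\<close>, where \<open>n\<close> is the order of \<open>\<sigma>\<close>.\<close>

definition is_central_left_multiple ::
    "('a::field \<Rightarrow> 'a) \<Rightarrow> nat \<Rightarrow> 'a poly \<Rightarrow> 'a poly \<Rightarrow> bool" where
  "is_central_left_multiple \<sigma> n f hh \<longleftrightarrow>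
     hh \<in> polys_over (fixed_field \<sigma>) \<and> lead_coeff hh = 1 \<and>
     right_divides (skew_poly_ring UNIV \<sigma>) f (subst_tn n hh)"

definition is_min_central_left_multiple ::
    "('a::field \<Rightarrow> 'a) \<Rightarrow> nat \<Rightarrow> 'a poly \<Rightarrow> 'a poly \<Rightarrow> bool" where
  "is_min_central_left_multiple \<sigma> n f hh \<longleftrightarrow>
     is_central_left_multiple \<sigma> n f hh \<and>
     (\<forall>g. is_central_left_multiple \<sigma> n f g \<longrightarrow>
            degree (subst_tn n hh) \<le> degree (subst_tn n g))"

text \<open>\<open>right_rem L \<sigma> g f\<close> is the remainder \<open>r\<close> in \<open>g = q f + r\<close>, computed in \<open>L[t;\<sigma>]\<close>. The
  condition \<open>deg r < deg f\<close> covers \<open>r = 0\<close> as soon as \<open>f\<close> is not constant.\<close>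

definition right_rem :: "'a::field set \<Rightarrow> ('a \<Rightarrow> 'a) \<Rightarrow> 'a poly \<Rightarrow> 'a poly \<Rightarrow> 'a poly" where
  "right_rem L \<sigma> g f =
     (THE r. r \<in> polys_over L \<and> degree r < degree f \<and>
             (\<exists>q \<in> polys_over L. g = skew_mult \<sigma> q f + r))"

text \<open>The nonassociative algebra \<open>L[t;\<sigma>]/L[t;\<sigma>]f\<close> for \<open>f\<close> of positive degree; the record type
  of rings is used for its operations only.\<close>

definition petit_algebra :: "'a::field set \<Rightarrow> ('a \<Rightarrow> 'a) \<Rightarrow> 'a poly \<Rightarrow> 'a poly ring" where
  "petit_algebra L \<sigma> f =
     \<lparr>carrier = {g \<in> polys_over L. degree g < degree f},
      monoid.mult = (\<lambda>g h. right_rem L \<sigma> (skew_mult \<sigma> g h) f),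
      one = 1, ring.zero = 0, add = (+)\<rparr>"

definition nuc_left :: "('b, 'c) monoid_scheme \<Rightarrow> 'b set" where
  "nuc_left S = {x \<in> carrier S. \<forall>y \<in> carrier S. \<forall>z \<in> carrier S.
     (x \<otimes>\<^bsub>S\<^esub> y) \<otimes>\<^bsub>S\<^esub> z = x \<otimes>\<^bsub>S\<^esub> (y \<otimes>\<^bsub>S\<^esub> z)}"

definition nuc_middle :: "('b, 'c) monoid_scheme \<Rightarrow> 'b set" where
  "nuc_middle S = {x \<in> carrier S. \<forall>y \<in> carrier S. \<forall>z \<in> carrier S.
     (y \<otimes>\<^bsub>S\<^esub> x) \<otimes>\<^bsub>S\<^esub> z = y \<otimes>\<^bsub>S\<^esub> (x \<otimes>\<^bsub>S\<^esub> z)}"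

definition nuc_right :: "('b, 'c) monoid_scheme \<Rightarrow> 'b set" where
  "nuc_right S = {x \<in> carrier S. \<forall>y \<in> carrier S. \<forall>z \<in> carrier S.
     (y \<otimes>\<^bsub>S\<^esub> z) \<otimes>\<^bsub>S\<^esub> x = y \<otimes>\<^bsub>S\<^esub> (z \<otimes>\<^bsub>S\<^esub> x)}"

definition nuc :: "('b, 'c) monoid_scheme \<Rightarrow> 'b set" where
  "nuc S = nuc_left S \<inter> nuc_middle S \<inter> nuc_right S"

text \<open>A set of constant polynomials, read as a subset of the coefficient field.\<close>

definition constants_in :: "'a::field poly set \<Rightarrow> 'a set" where
  "constants_in V = {a. [:a:] \<in> V}"

text \<open>The dimension \<open>[V : F]\<close> of a subset \<open>V\<close> of \<open>K[t;\<sigma>]\<close> over \<open>F = Fix(\<sigma>)\<close>, where \<open>F\<close> is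
  embedded as constant polynomials; meaningful for finite-dimensional subspaces \<open>V\<close>.\<close>

definition dim_over_fixed :: "('a::field \<Rightarrow> 'a) \<Rightarrow> 'a poly set \<Rightarrow> nat" where
  "dim_over_fixed \<sigma> V =
     ring.dim (skew_poly_ring UNIV \<sigma>) ((\<lambda>a. [:a:]) ` fixed_field \<sigma>) V"

end

theory Submission
  imports Defs
begin

text \<open>
  Since \<open>f\<close> has coefficients in \<open>F\<close>, multiplying by \<open>f\<close> on the right in \<open>R\<close> is ordinary
  multiplication of polynomials, so \<open>R f\<close> is the set of ordinary multiples of \<open>f\<close> and \<open>R / R f\<close> is
  \<open>K[t] / (f)\<close>, on which \<open>t\<close> acts \<open>\<sigma>\<close>-semilinearly from the left. The condition
  \<open>gcrd(f, t) = 1\<close> says that \<open>f\<close> has a nonzero constant coefficient, and makes this action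
  invertible. Let \<open>m = deg f\<close>, \<open>e = deg hh\<close> and \<open>s = [N : F]\<close>.

  Computing associators shows that \<open>Nuc\<^sub>r(S)\<close> is the set \<open>C\<close> of all \<open>g\<close> of degree less than \<open>m\<close>
  with \<open>f g \<in> R f\<close>, and that \<open>N\<close> is the set of constants in \<open>C\<close> when \<open>f\<close> is not right
  invariant. As \<open>t\<close> commutes with \<open>f\<close>, all polynomials of degree less than \<open>m\<close> with coefficients
  in \<open>N\<close> belong to \<open>C\<close>; they form a space of dimension \<open>s m\<close> over \<open>F\<close>. The proof compares this
  number with two facts that hold when \<open>hh\<close> is irreducible.

  The first is \<open>dim C \<le> m\<^sup>2 / e\<close> (\<open>idealizer_dimension_bound\<close>). An element of \<open>C\<close> acts on
  \<open>R / R f\<close> by right multiplication and commutes with the left action of \<open>R\<close>. The quotient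
  \<open>F[t] / (f)\<close> is a vector space over the field \<open>F[x] / (hh)\<close>, with \<open>x\<close> acting as \<open>t\<^sup>n\<close>, so it is
  spanned over \<open>F[x]\<close> by \<open>w\<close> elements with \<open>w e \<le> m\<close> (\<open>generators_over_centre\<close>). These elements
  generate \<open>R / R f\<close> over \<open>K[x]\<close>, hence a \<open>K\<close>-linear combination of elements of \<open>C\<close> is determined,
  as an operator, by its values at \<open>w\<close> vectors of a \<open>K\<close>-space of dimension \<open>m\<close>. Finally elements
  of \<open>C\<close> that are independent over \<open>F\<close> stay independent over \<open>K\<close> as operators: the \<open>K\<close>-linear
  relations between them form a space that is stable under \<open>\<sigma>\<^sup>-\<^sup>1\<close>, and such a space, if nonzero,
  contains a nonzero relation with coefficients in \<open>F\<close> (\<open>exists_fixed_vector\<close>). So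
  \<open>dim C \<le> w m \<le> m\<^sup>2 / e\<close>.

  The second is \<open>k m = l n e\<close> (\<open>factor_count\<close>): all irreducible factors of \<open>f\<close> and of \<open>h\<close> have the
  same degree. Indeed \<open>R / R h\<close> is a simple ring, so any two of its simple modules
  \<open>R / R p\<close> and \<open>R / R p'\<close> admit a nonzero homomorphism (\<open>exists_intertwiner\<close>).

  Together they give \<open>s m \<le> dim C \<le> m\<^sup>2 / e\<close>, that is, \<open>s \<le> m / e = l n / k\<close>. If equality holds, the
  polynomials over \<open>N\<close> fill \<open>C = Nuc\<^sub>r(S)\<close>. If \<open>s > l n / k\<close>, then \<open>hh\<close> cannot be
  irreducible, and then \<open>f\<close> is not irreducible either, because a factorization of \<open>hh\<close> would yield
  a left ideal strictly between \<open>R f\<close> and \<open>R\<close> (\<open>irreducible_imp_irreducible_hh\<close>).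
\<close>

section \<open>Linear algebra over a field\<close>

text \<open>Vectors indexed by \<open>I\<close> are given by their coordinates in \<open>D\<close>; one coordinate is eliminated at
  a time. Stating this for families rather than for sets of vectors allows repetitions.\<close>
lemma exists_linear_relation:
  fixes g :: "'i \<Rightarrow> 'x \<Rightarrow> 'a::field"
  assumes "finite D" "finite I" "card D < card I"
  shows "\<exists>a. (\<exists>i\<in>I. a i \<noteq> 0) \<and> (\<forall>x\<in>D. (\<Sum>i\<in>I. a i * g i x) = 0)"
  using assms
proof (induction D arbitrary: I g)
  case empty
  then obtain i where "i \<in> I"
    by fastforce
  then show ?case
    by (intro exI[of _ "\<lambda>_. 1"]) auto
next
  case (insert x D)
  show ?case
  proof (cases "\<forall>i\<in>I. g i x = 0")
    case True
    with insert.IH[of I g] insert.prems insert.hyps show ?thesis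
      by auto
  next
    case False
    then obtain i0 where i0: "i0 \<in> I" "g i0 x \<noteq> 0"
      by blast
    define g' where "g' i y = g i y - g i x / g i0 x * g i0 y" for i y
    have "card D < card (I - {i0})"
      using insert.prems insert.hyps i0 by simp
    then obtain a where
      a: "\<exists>i\<in>I - {i0}. a i \<noteq> 0" "\<forall>y\<in>D. (\<Sum>i\<in>I - {i0}. a i * g' i y) = 0"
      using insert.IH[of "I - {i0}" g'] insert.prems by blast
    define c where "c = - (\<Sum>i\<in>I - {i0}. a i * g i x) / g i0 x"
    have "(\<Sum>i\<in>I. (a(i0 := c)) i * g i y) = (\<Sum>i\<in>I - {i0}. a i * g' i y)" for y
    proof -
      have "(\<Sum>i\<in>I. (a(i0 := c)) i * g i y) = c * g i0 y + (\<Sum>i\<in>I - {i0}. a i * g i y)"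
        using i0 insert.prems by (subst sum.remove[of _ i0]) (auto intro!: sum.cong)
      also have "\<dots> = (\<Sum>i\<in>I - {i0}. a i * g' i y)"
        by (simp add: c_def g'_def right_diff_distrib sum_subtractf sum_distrib_right
            sum_divide_distrib sum_negf minus_divide_left[symmetric] mult.assoc)
      finally show ?thesis .
    qed
    moreover have "g' i x = 0" for i
      using i0 by (simp add: g'_def)
    ultimately show ?thesis
      using a by (intro exI[of _ "a(i0 := c)"]) auto
  qed
qed

text \<open>Galois descent. A nonzero vector \<open>b\<close> of minimal support, scaled to have a coordinate equal to
  \<open>1\<close>, is fixed by \<open>\<tau>\<close>: the difference of \<open>b\<close> and its image has smaller support, because \<open>\<tau>\<close>
  fixes \<open>1\<close>, so it vanishes.\<close>
lemma exists_fixed_vector: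
  fixes \<tau> :: "'a::field \<Rightarrow> 'a" and Z :: "('i \<Rightarrow> 'a) \<Rightarrow> bool"
  assumes "finite I" "\<tau> 0 = 0" "\<tau> 1 = 1"
    and diff: "\<And>a b. Z a \<Longrightarrow> Z b \<Longrightarrow> Z (\<lambda>i. a i - b i)"
    and scale: "\<And>a c. Z a \<Longrightarrow> Z (\<lambda>i. c * a i)"
    and twist: "\<And>a. Z a \<Longrightarrow> Z (\<lambda>i. \<tau> (a i))"
    and "Z a" "\<exists>i\<in>I. a i \<noteq> 0"
  shows "\<exists>b. Z b \<and> (\<exists>i\<in>I. b i \<noteq> 0) \<and> (\<forall>i\<in>I. \<tau> (b i) = b i)"
  using assms(7,8)
proof (induction "card {i\<in>I. a i \<noteq> 0}" arbitrary: a rule: less_induct)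
  case less
  then obtain i0 where i0: "i0 \<in> I" "a i0 \<noteq> 0"
    by blast
  define b where "b i = inverse (a i0) * a i" for i
  define d where "d i = b i - \<tau> (b i)" for i
  have Zb: "Z b" and Zd: "Z d"
    unfolding d_def b_def by (intro scale diff twist less.prems)+
  show ?case
  proof (cases "\<exists>i\<in>I. d i \<noteq> 0")
    case False
    with Zb i0 show ?thesis
      by (intro exI[of _ b]) (auto simp: d_def b_def)
  next
    case True
    have "d i0 = 0"
      using i0 assms by (simp add: d_def b_def)
    moreover have "a i \<noteq> 0" if "d i \<noteq> 0" for i
      using that assms(2) by (auto simp: d_def b_def)
    ultimately have "{i\<in>I. d i \<noteq> 0} \<subset> {i\<in>I. a i \<noteq> 0}"
      using i0 by blast
    then have "card {i\<in>I. d i \<noteq> 0} < card {i\<in>I. a i \<noteq> 0}"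
      using assms(1) by (intro psubset_card_mono) auto
    from less.hyps[OF this Zd True] show ?thesis .
  qed
qed

lemma poly_eq_0_if_small:
  "(p = 0 \<or> degree p < d) \<Longrightarrow> (\<And>i. i < d \<Longrightarrow> coeff p i = 0) \<Longrightarrow> p = 0"
  by (metis leading_coeff_0_iff)

lemma smult_sum_right: "smult c (sum g A) = (\<Sum>x\<in>A. smult c (g x))"
  by (induction A rule: infinite_finite_induct) (simp_all add: smult_add_right)

lemma poly_ring_over_simps [simp]:
  "carrier (poly_ring_over L) = polys_over L" "x \<otimes>\<^bsub>poly_ring_over L\<^esub> y = x * y"
  "\<one>\<^bsub>poly_ring_over L\<^esub> = 1" "\<zero>\<^bsub>poly_ring_over L\<^esub> = 0"
  by (simp_all add: poly_ring_over_def)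

lemma unit_poly_ring_over_iff:
  "u \<in> Units (poly_ring_over L) \<longleftrightarrow> u \<in> polys_over L \<and> (\<exists>v\<in>polys_over L. v * u = 1)"
  by (auto simp: Units_def mult.commute)

section \<open>Twisted polynomials\<close>

text \<open>Injectivity and surjectivity of \<open>\<sigma>\<close> follow from \<open>\<sigma>\<^sup>n = id\<close>.\<close>
locale finite_order_automorphism =
  fixes \<sigma> :: "'a::field \<Rightarrow> 'a" and n :: nat
  assumes hom_add: "\<sigma> (a + b) = \<sigma> a + \<sigma> b"
    and hom_mult: "\<sigma> (a * b) = \<sigma> a * \<sigma> b"
    and hom_one [simp]: "\<sigma> 1 = 1"
    and order: "has_order \<sigma> n"
begin

abbreviation skew_times (infixl "\<star>" 70) where "p \<star> q \<equiv> skew_mult \<sigma> p q"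

abbreviation "F \<equiv> fixed_field \<sigma>"

abbreviation "F_polys \<equiv> polys_over F"

lemma pow_add [simp]: "(\<sigma> ^^ i) (a + b) = (\<sigma> ^^ i) a + (\<sigma> ^^ i) b"
  by (induction i) (simp_all add: hom_add)

lemma pow_mult [simp]: "(\<sigma> ^^ i) (a * b) = (\<sigma> ^^ i) a * (\<sigma> ^^ i) b"
  by (induction i) (simp_all add: hom_mult)

lemma pow_zero [simp]: "(\<sigma> ^^ i) 0 = 0"
  using pow_add[of i 0 0] by (metis add_cancel_right_left add.right_neutral)

lemma pow_one [simp]: "(\<sigma> ^^ i) 1 = 1"
  by (induction i) simp_all

lemma hom_zero [simp]: "\<sigma> 0 = 0"
  using pow_zero[of 1] by simp

lemma pow_eq_0_iff [simp]: "(\<sigma> ^^ i) a = 0 \<longleftrightarrow> a = 0"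
proof
  assume "(\<sigma> ^^ i) a = 0"
  then show "a = 0"
    using pow_mult[of i a "inverse a"] by (cases "a = 0") auto
qed simp

lemma hom_eq_0_iff [simp]: "\<sigma> a = 0 \<longleftrightarrow> a = 0"
  using pow_eq_0_iff[of 1] by simp

lemma pow_uminus [simp]: "(\<sigma> ^^ i) (- a) = - (\<sigma> ^^ i) a"
  using pow_add[of i a "- a"] by (simp add: eq_neg_iff_add_eq_0 add.commute)

lemma pow_diff [simp]: "(\<sigma> ^^ i) (a - b) = (\<sigma> ^^ i) a - (\<sigma> ^^ i) b"
  using pow_add[of i a "- b"] by simp

lemma hom_uminus: "\<sigma> (- a) = - \<sigma> a"
  using pow_uminus[of 1] by simp

lemma hom_diff: "\<sigma> (a - b) = \<sigma> a - \<sigma> b"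
  using pow_diff[of 1] by simp

lemma hom_inverse: "\<sigma> (inverse a) = inverse (\<sigma> a)"
proof (cases "a = 0")
  case False
  then have "\<sigma> a * \<sigma> (inverse a) = 1"
    using hom_mult[of a "inverse a"] by simp
  then show ?thesis
    by (simp add: inverse_unique)
qed simp

lemma pow_sum [simp]: "(\<sigma> ^^ i) (\<Sum>x\<in>A. g x) = (\<Sum>x\<in>A. (\<sigma> ^^ i) (g x))"
  by (induction A rule: infinite_finite_induct) simp_all

lemma n_pos: "n > 0" and pow_n: "\<sigma> ^^ n = id"
  using order by (auto simp: has_order_def)

lemma pow_mult_n [simp]: "\<sigma> ^^ (n * i) = id"
  by (simp add: funpow_mult[symmetric] pow_n)

lemma pow_eq_id_iff: "\<sigma> ^^ i = id \<longleftrightarrow> n dvd i"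
proof
  assume "\<sigma> ^^ i = id"
  moreover have "\<sigma> ^^ i = \<sigma> ^^ (i mod n)"
    by (metis comp_id funpow_add mod_mult_div_eq pow_mult_n)
  ultimately have "\<not> 0 < i mod n"
    using order mod_less_divisor[OF n_pos, of i] unfolding has_order_def by metis
  then show "n dvd i"
    by auto
qed auto

abbreviation "\<tau> \<equiv> \<sigma> ^^ (n - Suc 0)"

lemma hom_inv [simp]: "\<sigma> (\<tau> a) = a" "\<tau> (\<sigma> a) = a"
proof -
  have "\<sigma> ^^ n = \<sigma> \<circ> \<tau>" "\<sigma> ^^ n = \<tau> \<circ> \<sigma>"
    using n_pos by (metis Suc_pred funpow.simps(2), metis Suc_pred funpow_Suc_right)
  then show "\<sigma> (\<tau> a) = a" "\<tau> (\<sigma> a) = a"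
    by (simp_all add: pow_n fun_eq_iff)
qed

lemma fixed_pow: "a \<in> F \<Longrightarrow> (\<sigma> ^^ i) a = a"
  by (induction i) (simp_all add: fixed_field_def)

lemma F_I: "\<tau> a = a \<Longrightarrow> a \<in> F"
  unfolding fixed_field_def using hom_inv(1)[of a] by simp

lemma F_simps [simp]:
  "0 \<in> F" "1 \<in> F" "a \<in> F \<Longrightarrow> b \<in> F \<Longrightarrow> a + b \<in> F" "a \<in> F \<Longrightarrow> - a \<in> F"
  "a \<in> F \<Longrightarrow> b \<in> F \<Longrightarrow> a - b \<in> F" "a \<in> F \<Longrightarrow> b \<in> F \<Longrightarrow> a * b \<in> F" "a \<in> F \<Longrightarrow> inverse a \<in> F"
  by (simp_all add: fixed_field_def hom_add hom_mult hom_uminus hom_diff hom_inverse)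

lemma coeff_skew_mult:
  "coeff (p \<star> q) k = (\<Sum>i\<le>k. coeff p i * (\<sigma> ^^ i) (coeff q (k - i)))"
proof -
  have inner: "(\<Sum>j\<le>degree q. if i + j = k then coeff p i * (\<sigma> ^^ i) (coeff q j) else 0) =
      (if i \<le> k then coeff p i * (\<sigma> ^^ i) (coeff q (k - i)) else 0)" for i
  proof (cases "i \<le> k")
    case True
    then have "(i + j = k) = (j = k - i)" for j
      by auto
    with True show ?thesis
      by (auto simp: coeff_eq_0)
  qed auto
  have "coeff (p \<star> q) k =
      (\<Sum>i\<le>degree p. if i \<le> k then coeff p i * (\<sigma> ^^ i) (coeff q (k - i)) else 0)"
    unfolding skew_mult_def by (simp add: coeff_sum inner)
  also have "\<dots> = (\<Sum>i\<in>{..degree p} \<inter> {..k}. coeff p i * (\<sigma> ^^ i) (coeff q (k - i)))"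
    by (simp add: sum.inter_restrict[symmetric] Int_def flip: sum.inter_filter)
  also have "\<dots> = (\<Sum>i\<le>k. coeff p i * (\<sigma> ^^ i) (coeff q (k - i)))"
    by (rule sum.mono_neutral_left) (auto simp: coeff_eq_0)
  finally show ?thesis .
qed

lemma skew_add_left [simp]: "(p + q) \<star> r = p \<star> r + q \<star> r"
  by (rule poly_eqI) (simp add: coeff_skew_mult algebra_simps sum.distrib)

lemma skew_add_right [simp]: "p \<star> (q + r) = p \<star> q + p \<star> r"
  by (rule poly_eqI) (simp add: coeff_skew_mult algebra_simps sum.distrib)

lemma skew_zero [simp]: "0 \<star> p = 0" "p \<star> 0 = 0"
  by (rule poly_eqI, simp add: coeff_skew_mult)+

lemma skew_uminus [simp]: "(- p) \<star> q = - (p \<star> q)" "p \<star> (- q) = - (p \<star> q)"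
  by (rule poly_eqI, simp add: coeff_skew_mult sum_negf)+

lemma skew_diff_left [simp]: "(p - q) \<star> r = p \<star> r - q \<star> r"
  using skew_add_left[of p "- q" r] by simp

lemma skew_diff_right [simp]: "p \<star> (q - r) = p \<star> q - p \<star> r"
  using skew_add_right[of p q "- r"] by simp

lemma skew_smult_left [simp]: "smult a p \<star> q = smult a (p \<star> q)"
  by (rule poly_eqI) (simp add: coeff_skew_mult sum_distrib_left mult.assoc)

lemma skew_sum_left: "(\<Sum>i\<in>A. g i) \<star> q = (\<Sum>i\<in>A. g i \<star> q)"
  by (induction A rule: infinite_finite_induct) simp_all

lemma skew_sum_right: "p \<star> (\<Sum>i\<in>A. g i) = (\<Sum>i\<in>A. p \<star> g i)"
  by (induction A rule: infinite_finite_induct) simp_all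

lemma monom_skew:
  "coeff (monom a i \<star> q) k = (if i \<le> k then a * (\<sigma> ^^ i) (coeff q (k - i)) else 0)"
proof -
  have "coeff (monom a i \<star> q) k = (\<Sum>j\<le>k. if j = i then a * (\<sigma> ^^ j) (coeff q (k - j)) else 0)"
    unfolding coeff_skew_mult by (rule sum.cong) (auto)
  then show ?thesis
    by auto
qed

lemma monom_skew_monom: "monom a i \<star> monom b j = monom (a * (\<sigma> ^^ i) b) (i + j)"
  by (rule poly_eqI) (auto simp: monom_skew)

text \<open>Identities that are additive in each argument, such as associativity, need to be checked on
  monomials only.\<close>
lemma poly_monom_induct:
  assumes "\<And>a i. P (monom a i)" and "\<And>p q. P p \<Longrightarrow> P q \<Longrightarrow> P (p + q)"
  shows "P (p :: 'a poly)"
proof -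
  have "P (\<Sum>i\<in>A. monom (coeff p i) i)" if "finite A" for A
    using that by (induction A) (use assms assms(1)[of 0 0] in auto)
  from this[of "{..degree p}"] show ?thesis
    by (simp add: poly_as_sum_of_monoms)
qed

lemma skew_assoc: "(p \<star> q) \<star> r = p \<star> (q \<star> r)"
proof (induction p rule: poly_monom_induct)
  case (1 a i)
  show ?case
  proof (induction q rule: poly_monom_induct)
    case (1 b j)
    show ?case
      by (induction r rule: poly_monom_induct)
        (simp_all add: monom_skew_monom add.assoc mult.assoc funpow_add)
  qed simp
qed simp

lemma const_skew [simp]: "[:a:] \<star> q = smult a q"
  by (rule poly_eqI) (simp add: monom_skew flip: monom_0)

lemma one_skew [simp]: "1 \<star> q = q"
  by (simp add: one_pCons)

lemma skew_one [simp]: "p \<star> 1 = p"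
  by (induction p rule: poly_monom_induct) (simp_all add: monom_skew_monom flip: monom_eq_1)

lemma coeff_skew_const [simp]: "coeff (p \<star> [:a:]) k = coeff p k * (\<sigma> ^^ k) a"
  by (induction p rule: poly_monom_induct)
    (auto simp: monom_skew_monom algebra_simps simp flip: monom_0)

lemma coeff_0_skew [simp]: "coeff (p \<star> q) 0 = coeff p 0 * coeff q 0"
  by (simp add: coeff_skew_mult)

lemma coeff_skew_degree_sum:
  "coeff (p \<star> q) (degree p + degree q) = lead_coeff p * (\<sigma> ^^ degree p) (lead_coeff q)"
proof -
  have "coeff (p \<star> q) (degree p + degree q) = (\<Sum>i\<le>degree p + degree q.
      if i = degree p then lead_coeff p * (\<sigma> ^^ degree p) (lead_coeff q) else 0)"
    unfolding coeff_skew_mult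
  proof (rule sum.cong)
    fix i
    show "coeff p i * (\<sigma> ^^ i) (coeff q (degree p + degree q - i)) =
      (if i = degree p then lead_coeff p * (\<sigma> ^^ degree p) (lead_coeff q) else 0)"
      by (cases i "degree p" rule: linorder_cases) (auto simp: coeff_eq_0)
  qed simp
  then show ?thesis
    by simp
qed

lemma degree_skew_le: "degree (p \<star> q) \<le> degree p + degree q"
proof (rule degree_le, intro allI impI)
  fix k assume k: "degree p + degree q < k"
  have "coeff p i * (\<sigma> ^^ i) (coeff q (k - i)) = 0" for i
    using k by (cases "i \<le> degree p") (auto simp: coeff_eq_0)
  then show "coeff (p \<star> q) k = 0"
    unfolding coeff_skew_mult by (intro sum.neutral ballI)
qed

lemma degree_skew: "p \<noteq> 0 \<Longrightarrow> q \<noteq> 0 \<Longrightarrow> degree (p \<star> q) = degree p + degree q"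
  by (metis coeff_skew_degree_sum degree_skew_le le_antisym le_degree leading_coeff_0_iff
      mult_eq_0_iff pow_eq_0_iff)

lemma skew_eq_0_iff [simp]: "p \<star> q = 0 \<longleftrightarrow> p = 0 \<or> q = 0"
  by (metis coeff_0 coeff_skew_degree_sum leading_coeff_0_iff mult_eq_0_iff pow_eq_0_iff skew_zero)

lemma lead_coeff_skew: "lead_coeff (p \<star> q) = lead_coeff p * (\<sigma> ^^ degree p) (lead_coeff q)"
  by (cases "p = 0 \<or> q = 0") (use coeff_skew_degree_sum degree_skew in auto)

lemma skew_cancel_right: "q \<noteq> 0 \<Longrightarrow> p \<star> q = p' \<star> q \<Longrightarrow> p = p'"
  using skew_eq_0_iff[of "p - p'" q] by simp

lemma right_division:
  assumes "d \<noteq> 0"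
  shows "\<exists>q r. g = q \<star> d + r \<and> (r = 0 \<or> degree r < degree d)"
proof (induction "degree g" arbitrary: g rule: less_induct)
  case less
  show ?case
  proof (cases "g = 0 \<or> degree g < degree d")
    case True
    then show ?thesis
      by (intro exI[of _ 0] exI[of _ g]) auto
  next
    case False
    define i where "i = degree g - degree d"
    define a where "a = lead_coeff g / (\<sigma> ^^ i) (lead_coeff d)"
    define s where "s = monom a i \<star> d"
    have a: "a \<noteq> 0" and i: "i + degree d = degree g"
      using False assms by (auto simp: a_def i_def)
    have deg: "degree s = degree g"
      using a i assms degree_skew[of "monom a i" d] by (simp add: s_def degree_monom_eq)
    have "lead_coeff s = a * (\<sigma> ^^ i) (lead_coeff d)"
      using a by (simp add: s_def lead_coeff_skew degree_monom_eq)
    then have lead: "lead_coeff s = lead_coeff g"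
      using assms by (simp add: a_def)
    show ?thesis
    proof (cases "g - s = 0")
      case True
      then show ?thesis
        by (intro exI[of _ "monom a i"] exI[of _ 0]) (auto simp: s_def)
    next
      case False
      have "degree (g - s) < degree g"
      proof (rule ccontr)
        assume "\<not> ?thesis"
        then have "degree (g - s) = degree g"
          using degree_diff_le_max[of g s] deg by simp
        then have "lead_coeff (g - s) = 0"
          using lead deg by (metis coeff_diff right_minus_eq)
        with False show False
          by (simp only: leading_coeff_0_iff)
      qed
      from less[OF this] obtain q r where
        qr: "g - s = q \<star> d + r" "r = 0 \<or> degree r < degree d"
        by blast
      then have "g = (q + monom a i) \<star> d + r"
        by (simp add: s_def algebra_simps)
      with qr(2) show ?thesis
        by blast
    qed
  qed
qed

lemma polys_over_iff: "p \<in> polys_over L \<longleftrightarrow> (\<forall>i. coeff p i \<in> L)"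
  by (auto simp: polys_over_def)

text \<open>Right multiplication by a polynomial over \<open>F\<close> never applies \<open>\<sigma>\<close> to anything but fixed
  elements. This is what turns left multiples of \<open>f\<close> into ordinary multiples.\<close>
lemma skew_F_poly [simp]: "q \<in> F_polys \<Longrightarrow> p \<star> q = p * q"
  by (rule poly_eqI) (simp add: coeff_skew_mult coeff_mult polys_over_iff fixed_pow)

abbreviation "coeffwise \<equiv> map_poly \<sigma>"

lemma coeff_coeffwise [simp]: "coeff (coeffwise p) i = \<sigma> (coeff p i)"
  by (simp add: coeff_map_poly)

lemma F_polys_iff_coeffwise: "p \<in> F_polys \<longleftrightarrow> coeffwise p = p"
  by (auto simp: polys_over_iff fixed_field_def poly_eq_iff)

lemma coeffwise_add [simp]: "coeffwise (p + q) = coeffwise p + coeffwise q"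
  by (rule poly_eqI) (simp add: hom_add)

lemma hom_sum: "\<sigma> (\<Sum>x\<in>A. g x) = (\<Sum>x\<in>A. \<sigma> (g x))"
  using pow_sum[of 1] by simp

lemma coeffwise_mult [simp]: "coeffwise (p * q) = coeffwise p * coeffwise q"
  by (rule poly_eqI) (simp add: coeff_mult hom_sum hom_mult)

lemma degree_coeffwise [simp]: "degree (coeffwise p) = degree p"
  by (rule degree_map_poly) simp

lemma F_polys_simps [simp]:
  "0 \<in> F_polys" "1 \<in> F_polys" "p \<in> F_polys \<Longrightarrow> q \<in> F_polys \<Longrightarrow> p + q \<in> F_polys"
  "p \<in> F_polys \<Longrightarrow> q \<in> F_polys \<Longrightarrow> p * q \<in> F_polys"
  "p \<in> F_polys \<Longrightarrow> - p \<in> F_polys" "p \<in> F_polys \<Longrightarrow> q \<in> F_polys \<Longrightarrow> p - q \<in> F_polys"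
  "a \<in> F \<Longrightarrow> p \<in> F_polys \<Longrightarrow> smult a p \<in> F_polys"
  "a \<in> F \<Longrightarrow> monom a i \<in> F_polys"
  by (simp_all add: F_polys_iff_coeffwise)
     (auto simp: polys_over_iff poly_eq_iff fixed_field_def hom_mult hom_uminus hom_diff)

lemma F_polys_sum: "(\<And>x. x \<in> A \<Longrightarrow> g x \<in> F_polys) \<Longrightarrow> sum g A \<in> F_polys"
  by (induction A rule: infinite_finite_induct) simp_all

text \<open>Quotient and remainder in \<open>K[t]\<close> are unique, hence invariant under \<open>\<sigma>\<close> when the arguments
  are.\<close>
lemma F_polys_mod [simp]:
  assumes "p \<in> F_polys" "d \<in> F_polys"
  shows "p div d \<in> F_polys" "p mod d \<in> F_polys"
proof -
  show *: "p div d \<in> F_polys"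
  proof (cases "d = 0")
    case False
    have "p = d * (p div d) + p mod d"
      by simp
    then have "p = d * coeffwise (p div d) + coeffwise (p mod d)"
      using assms unfolding F_polys_iff_coeffwise by (metis coeffwise_add coeffwise_mult)
    moreover have "coeffwise (p mod d) div d = 0"
      using degree_mod_less[OF False, of p] by (auto simp: div_poly_eq_0_iff)
    ultimately have "p div d = coeffwise (p div d)"
      using False by (metis add.right_neutral div_mult_self3 add.commute mult.commute)
    then show ?thesis
      by (simp add: F_polys_iff_coeffwise)
  qed simp
  show "p mod d \<in> F_polys"
    using * assms by (simp add: minus_div_mult_eq_mod[symmetric])
qed

section \<open>Polynomials in the central element\<close>

abbreviation subst where "subst p \<equiv> subst_tn n p"

lemma subst_simps [simp]:
  "subst (p + q) = subst p + subst q" "subst (p - q) = subst p - subst q"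
  "subst (p * q) = subst p * subst q" "subst (- p) = - subst p" "subst 0 = 0" "subst 1 = 1"
  "degree (subst p) = degree p * n" "subst (smult a p) = smult a (subst p)"
  by (simp_all add: subst_tn_def pcompose_add pcompose_diff pcompose_mult pcompose_uminus
      pcompose_smult degree_pcompose degree_monom_eq pcompose_1)

lemma subst_sum: "subst (sum g A) = (\<Sum>x\<in>A. subst (g x))"
  by (simp add: subst_tn_def pcompose_sum)

lemma subst_monom: "subst (monom a i) = monom a (n * i)"
  by (induction i) (simp_all add: subst_tn_def monom_0 monom_Suc pcompose_pCons mult_monom
      smult_monom flip: monom_altdef)

lemma subst_altdef: "subst p = (\<Sum>i\<le>degree p. monom (coeff p i) (n * i))"
  by (subst (1) poly_as_sum_of_monoms[of p, symmetric]) (simp only: subst_sum subst_monom)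

lemma subst_F_poly [simp]: "p \<in> F_polys \<Longrightarrow> subst p \<in> F_polys"
  unfolding subst_altdef by (intro F_polys_sum) (simp add: polys_over_iff)

lemma monom_n_skew: "monom a (n * i) \<star> q = monom a (n * i) * q"
  by (rule poly_eqI) (auto simp: monom_skew coeff_monom_mult)

text \<open>\<open>t\<^sup>n\<close> commutes with all coefficients, since \<open>\<sigma>\<^sup>n = id\<close>.\<close>
lemma subst_skew [simp]: "subst p \<star> q = subst p * q"
  by (simp add: subst_altdef skew_sum_left sum_distrib_right monom_n_skew)

lemma subst_eq_0_iff [simp]: "subst p = 0 \<longleftrightarrow> p = 0"
  using n_pos by (simp add: subst_tn_def pcompose_eq_0_iff degree_monom_eq)

text \<open>\<open>F\<close> is a set rather than a type, so the ideal of \<open>F[x]\<close> generated by \<open>u\<close> and \<open>g\<close> is handled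
  directly. An element \<open>d\<close> of least degree generates it; as \<open>d\<close> divides the irreducible \<open>g\<close>, it is
  a unit or associated to \<open>g\<close>, and the latter is excluded because \<open>d\<close> divides \<open>u\<close>.\<close>
lemma F_bezout:
  assumes irr: "irreducible_elem (poly_ring_over F) g"
    and u: "u \<in> F_polys" "\<not> g dvd u"
  shows "\<exists>\<alpha>\<in>F_polys. \<exists>\<beta>\<in>F_polys. \<alpha> * u + \<beta> * g = 1"
proof -
  define J where "J = {\<alpha> * u + \<beta> * g | \<alpha> \<beta>. \<alpha> \<in> F_polys \<and> \<beta> \<in> F_polys}"
  have g: "g \<in> F_polys" "g \<noteq> 0"
    using irr by (auto simp: irreducible_elem_def)
  have J_F: "x \<in> F_polys" if "x \<in> J" for x
    using that u g by (auto simp: J_def)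
  have J_lin: "x - c * y \<in> J" if xy: "x \<in> J" "y \<in> J" "c \<in> F_polys" for x y c
  proof -
    obtain a b a' b' where "x = a * u + b * g" "y = a' * u + b' * g"
      and ab: "a \<in> F_polys" "b \<in> F_polys" "a' \<in> F_polys" "b' \<in> F_polys"
      using xy by (auto simp: J_def)
    then have "x - c * y = (a - c * a') * u + (b - c * b') * g"
      by (simp add: algebra_simps)
    with ab xy(3) show ?thesis
      unfolding J_def by (metis (mono_tags, lifting) F_polys_simps(4,6) mem_Collect_eq)
  qed
  have "g = 0 * u + 1 * g" "u = 1 * u + 0 * g"
    by simp_all
  then have gJ: "g \<in> J" and uJ: "u \<in> J"
    unfolding J_def using F_polys_simps(1,2) by blast+
  obtain d where d: "d \<in> J" "d \<noteq> 0" and min: "\<And>x. x \<in> J \<Longrightarrow> x \<noteq> 0 \<Longrightarrow> degree d \<le> degree x"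
    using ex_has_least_nat[of "\<lambda>x. x \<in> J \<and> x \<noteq> 0" g degree] gJ g by blast
  have d_dvd: "d dvd x" if "x \<in> J" for x
  proof -
    have "x mod d \<in> J"
      using J_lin[OF that d(1), of "x div d"] J_F d that
      by (simp add: minus_div_mult_eq_mod)
    then have "x mod d = 0"
      using min degree_mod_less[OF d(2), of x] by force
    then show ?thesis
      by auto
  qed
  have "g = (g div d) * d"
    using d_dvd[OF gJ] by simp
  moreover have dF: "d \<in> F_polys" "g div d \<in> F_polys"
    using J_F d g by auto
  ultimately consider "g div d \<in> Units (poly_ring_over F)" | "d \<in> Units (poly_ring_over F)"
    using irr unfolding irreducible_elem_def poly_ring_over_simps by blast
  then show ?thesis
  proof cases
    case 1
    then obtain v where "v * (g div d) = 1"
      by (auto simp: unit_poly_ring_over_iff)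
    then have "v * g = d"
      by (metis \<open>g = (g div d) * d\<close> mult.assoc mult_1)
    then show ?thesis
      using d_dvd[OF uJ] u by (metis dvd_mult_right)
  next
    case 2
    then obtain v where v: "v \<in> F_polys" "v * d = 1"
      by (auto simp: unit_poly_ring_over_iff)
    obtain a b where ab: "a \<in> F_polys" "b \<in> F_polys" "d = a * u + b * g"
      using d by (auto simp: J_def)
    then have "(v * a) * u + (v * b) * g = 1"
      using v by (simp add: algebra_simps)
    with v ab show ?thesis
      by (metis F_polys_simps(4))
  qed
qed

section \<open>Left ideals\<close>

abbreviation "R \<equiv> skew_poly_ring UNIV \<sigma>"

abbreviation t where "t \<equiv> monom 1 (Suc 0) :: 'a poly"

lemma R_simps [simp]:
  "carrier R = UNIV" "x \<otimes>\<^bsub>R\<^esub> y = x \<star> y" "x \<oplus>\<^bsub>R\<^esub> y = x + y" "\<one>\<^bsub>R\<^esub> = 1" "\<zero>\<^bsub>R\<^esub> = 0"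
  by (simp_all add: skew_poly_ring_def polys_over_def)

lemma t_F [simp]: "t \<in> F_polys"
  by simp

lemma coeff_times_t: "coeff (p * t) k = (if k = 0 then 0 else coeff p (k - 1))"
  by (simp add: mult.commute[of p t] coeff_monom_mult)

lemma t_skew: "t \<star> p = coeffwise p * t"
  by (rule poly_eqI) (simp add: monom_skew coeff_times_t)

lemma skew_smult_F [simp]: "a \<in> F \<Longrightarrow> p \<star> smult a q = smult a (p \<star> q)"
  by (rule poly_eqI) (simp add: coeff_skew_mult fixed_pow sum_distrib_left mult.left_commute)

lemma poly_split_0: "[:coeff p 0:] + poly_shift (Suc 0) p * t = p"
  by (rule poly_eqI) (simp add: coeff_times_t coeff_poly_shift coeff_pCons split: nat.splits)

definition left_multiples where "left_multiples p = range (\<lambda>q. q \<star> p)"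

lemma left_multiplesI: "x = q \<star> p \<Longrightarrow> x \<in> left_multiples p"
  by (auto simp: left_multiples_def)

lemma left_multiples_simps [simp]:
  "x \<in> left_multiples p \<Longrightarrow> y \<in> left_multiples p \<Longrightarrow> x + y \<in> left_multiples p"
  "x \<in> left_multiples p \<Longrightarrow> y \<in> left_multiples p \<Longrightarrow> x - y \<in> left_multiples p"
  "x \<in> left_multiples p \<Longrightarrow> q \<star> x \<in> left_multiples p"
  "x \<in> left_multiples p \<Longrightarrow> smult a x \<in> left_multiples p"
  "p \<in> left_multiples p" "0 \<in> left_multiples p"
proof -
  show "q \<star> x \<in> left_multiples p" if "x \<in> left_multiples p" for q x
    using that by (auto simp: left_multiples_def simp flip: skew_assoc)
  from this[of _ "[:a:]"] show "x \<in> left_multiples p \<Longrightarrow> smult a x \<in> left_multiples p"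
    by simp
qed (auto simp: left_multiples_def simp flip: skew_add_left skew_diff_left
    intro: rangeI[of "\<lambda>q. q \<star> p" 1, simplified] rangeI[of "\<lambda>q. q \<star> p" 0, simplified])

lemma left_multiples_sum:
  "(\<And>i. i \<in> A \<Longrightarrow> g i \<in> left_multiples p) \<Longrightarrow> sum g A \<in> left_multiples p"
  by (induction A rule: infinite_finite_induct) simp_all

lemma left_multiples_F_poly: "p \<in> F_polys \<Longrightarrow> x \<in> left_multiples p \<longleftrightarrow> p dvd x"
  by (auto simp: left_multiples_def dvd_def mult.commute)

text \<open>Left ideals of \<open>R\<close> are principal, so an irreducible element generates a maximal one.\<close>
lemma irreducible_left_ideal:
  assumes irr: "irreducible_elem R p" and pJ: "p \<in> J"
    and diff: "\<And>x y. x \<in> J \<Longrightarrow> y \<in> J \<Longrightarrow> x - y \<in> J"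
    and mult: "\<And>q x. x \<in> J \<Longrightarrow> q \<star> x \<in> J"
    and "1 \<notin> J"
  shows "J \<subseteq> left_multiples p"
proof
  fix x assume x: "x \<in> J"
  have "p \<noteq> 0"
    using irr by (simp add: irreducible_elem_def)
  then obtain d where d: "d \<in> J" "d \<noteq> 0" and min: "\<And>x. x \<in> J \<Longrightarrow> x \<noteq> 0 \<Longrightarrow> degree d \<le> degree x"
    using ex_has_least_nat[of "\<lambda>x. x \<in> J \<and> x \<noteq> 0" p degree] pJ by blast
  have mult_d: "\<exists>q. y = q \<star> d" if "y \<in> J" for y
  proof -
    obtain q r where qr: "y = q \<star> d + r" "r = 0 \<or> degree r < degree d"
      using right_division[OF d(2)] by blast
    then have "r = y - q \<star> d"
      by simp
    then have "r \<in> J"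
      using diff mult d that by blast
    with qr min show ?thesis
      by fastforce
  qed
  obtain y where y: "p = y \<star> d"
    using mult_d pJ by blast
  then consider "y \<in> Units R" | "d \<in> Units R"
    using irr unfolding irreducible_elem_def R_simps by blast
  then show "x \<in> left_multiples p"
  proof cases
    case 1
    then obtain v where "v \<star> y = 1"
      by (auto simp: Units_def)
    then have "d = v \<star> p"
      using y by (simp flip: skew_assoc)
    then show ?thesis
      using mult_d[OF x] by (auto simp: left_multiples_def simp flip: skew_assoc)
  next
    case 2
    then obtain v where "v \<star> d = 1"
      by (auto simp: Units_def)
    with mult[OF d(1), of v] \<open>1 \<notin> J\<close> show ?thesis
      by simp
  qed
qed

text \<open>A one-sided inverse suffices because \<open>R\<close> has no zero divisors.\<close>
lemma irreducible_not_one: "irreducible_elem R p \<Longrightarrow> 1 \<notin> left_multiples p"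
proof
  assume irr: "irreducible_elem R p" and "1 \<in> left_multiples p"
  then obtain v where v: "v \<star> p = 1"
    by (auto simp: left_multiples_def)
  then have "(p \<star> v) \<star> p = 1 \<star> p"
    by (simp add: skew_assoc)
  then have "p \<star> v = 1"
    using irr skew_cancel_right by (metis R_simps(5) irreducible_elem_def)
  with v irr show False
    by (auto simp: irreducible_elem_def Units_def)
qed

lemma unit_of_degree_0: "degree p = 0 \<Longrightarrow> p \<noteq> 0 \<Longrightarrow> p \<in> Units R"
proof -
  assume "degree p = 0" "p \<noteq> 0"
  then obtain a where "p = [:a:]" "a \<noteq> 0"
    by (metis degree_eq_zeroE pCons_0_0)
  then show ?thesis
    by (auto simp: Units_def one_pCons intro!: exI[of _ "[:inverse a:]"])
qed

lemma irreducible_degree_pos: "irreducible_elem R p \<Longrightarrow> degree p > 0"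
  using unit_of_degree_0[of p] by (auto simp: irreducible_elem_def)

lemma coeff_subst: "coeff (subst p) k = (if n dvd k then coeff p (k div n) else 0)"
proof -
  have "coeff (subst p) k = (\<Sum>i\<le>degree p. if n * i = k then coeff p i else 0)"
    by (simp add: subst_altdef coeff_sum)
  also have "\<dots> = (if n dvd k then coeff p (k div n) else 0)"
  proof (cases "n dvd k")
    case True
    then have "(n * i = k) = (i = k div n)" for i
      using n_pos by auto
    with True show ?thesis
      by (auto simp: coeff_eq_0)
  next
    case False
    then have "n * i \<noteq> k" for i
      by auto
    with False show ?thesis
      by simp
  qed
  finally show ?thesis .
qed

text \<open>The hypotheses describe the centre: commuting with \<open>t\<close> forces the coefficients into \<open>F\<close>, and
  commuting with \<open>K\<close> forces the exponents into multiples of \<open>n\<close>.\<close>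
lemma central_imp_subst:
  assumes "g \<in> F_polys" "\<And>k. coeff g k \<noteq> 0 \<Longrightarrow> n dvd k"
  shows "\<exists>c\<in>F_polys. g = subst c"
proof -
  define c where "c = (\<Sum>k\<le>degree g. monom (coeff g (n * k)) k)"
  have coeff_c: "coeff c k = coeff g (n * k)" for k
  proof (cases "k \<le> degree g")
    case False
    then have "degree g < n * k"
      using n_pos by (metis less_le_trans not_le mult_le_mono1 mult_1 One_nat_def Suc_leI)
    with False show ?thesis
      by (simp add: c_def coeff_sum coeff_eq_0)
  qed (simp add: c_def coeff_sum)
  have "g = subst c"
    by (rule poly_eqI) (use assms(2) in \<open>auto simp: coeff_subst coeff_c\<close>)
  moreover have "c \<in> F_polys"
    using assms(1) by (simp add: polys_over_iff coeff_c)
  ultimately show ?thesis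
    by blast
qed

lemma t_dvd_cancel:
  assumes "f dvd t ^ i * q" "coeff f 0 \<noteq> (0 :: 'a)"
  shows "f dvd q"
  using assms(1)
proof (induction i arbitrary: q)
  case (Suc i)
  then obtain z where z: "t * (t ^ i * q) = f * z"
    unfolding dvd_def power_Suc by (auto simp only: mult.assoc)
  then have "coeff f 0 * coeff z 0 = coeff (t * (t ^ i * q)) 0"
    by (simp only: coeff_mult_0)
  then have "coeff z 0 = 0"
    using assms(2) by (simp add: coeff_mult_0)
  then have "poly_shift (Suc 0) z * t = z"
    using poly_split_0[of z] by simp
  then have "t * (t ^ i * q) = f * (poly_shift (Suc 0) z * t)"
    by (simp only: z)
  also have "\<dots> = t * (f * poly_shift (Suc 0) z)"
    by (simp only: ac_simps)
  finally have "t ^ i * q = f * poly_shift (Suc 0) z"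
    by (simp only: mult_cancel_left monom_eq_0_iff one_neq_zero simp_thms)
  then have "f dvd t ^ i * q"
    by simp
  then show ?case
    by (rule Suc.IH)
qed simp

section \<open>Dimension over the fixed field\<close>

lemma polys_over_UNIV [simp]: "polys_over UNIV = UNIV"
  by (auto simp: polys_over_def)

lemma ring_R: "ring R"
proof -
  have "\<exists>y. x + y = 0" for x :: "'a poly"
    using add.right_inverse by blast
  then show ?thesis
    using add.right_inverse
    by unfold_locales (auto simp: algebra_simps skew_assoc Units_def)
qed

abbreviation "F_consts \<equiv> (\<lambda>a. [:a:]) ` F"

lemma subfield_F_consts: "subfield F_consts R"
proof -
  interpret ring R by (rule ring_R)
  have minus: "\<ominus>\<^bsub>R\<^esub> x = - x" for x
    by (rule minus_equality) simp_all
  show ?thesis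
  proof (rule subfieldI[OF subcringI[OF subringI]])
    have "[:1:] \<in> F_consts"
      by (rule imageI) simp
    then show "\<one>\<^bsub>R\<^esub> \<in> F_consts"
      by (simp add: one_pCons)
    show "Units (R\<lparr>carrier := F_consts\<rparr>) = F_consts - {\<zero>\<^bsub>R\<^esub>}"
    proof (intro equalityI subsetI)
      fix x assume "x \<in> Units (R\<lparr>carrier := F_consts\<rparr>)"
      then obtain y where "x \<in> F_consts" "y \<star> x = 1"
        by (auto simp: Units_def simp del: const_skew)
      then show "x \<in> F_consts - {\<zero>\<^bsub>R\<^esub>}"
        by auto
    next
      fix x assume "x \<in> F_consts - {\<zero>\<^bsub>R\<^esub>}"
      then obtain a where a: "x = [:a:]" "a \<in> F" "a \<noteq> 0"
        by auto
      then have "[:inverse a:] \<in> F_consts"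
        by (intro imageI) simp
      moreover have "[:inverse a:] \<star> x = 1" "x \<star> [:inverse a:] = 1"
        using a by (simp_all add: one_pCons)
      ultimately have "\<exists>y\<in>F_consts. y \<star> x = 1 \<and> x \<star> y = 1"
        by blast
      then show "x \<in> Units (R\<lparr>carrier := F_consts\<rparr>)"
        using a(1,2) unfolding Units_def by (simp del: const_skew)
    qed
  qed (auto simp: minus intro!: imageI)
qed

definition F_independent :: "nat \<Rightarrow> (nat \<Rightarrow> 'a poly) \<Rightarrow> bool" where
  "F_independent s w \<longleftrightarrow>
     (\<forall>b. (\<forall>i<s. b i \<in> F) \<and> (\<Sum>i<s. smult (b i) (w i)) = 0 \<longrightarrow> (\<forall>i<s. b i = 0))"

lemma combine_eq_sum:
  "length Ks = length Us \<Longrightarrow> ring.combine R Ks Us = (\<Sum>i<length Us. (Ks ! i) \<star> (Us ! i))"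
proof (induction Us arbitrary: Ks)
  case Nil
  then show ?case
    using ring.combine.simps(2)[OF ring_R] by simp
next
  case (Cons u Us)
  then obtain k Ks' where "Ks = k # Ks'"
    by (cases Ks) auto
  with Cons show ?case
    using ring.combine.simps(1)[OF ring_R] by (simp add: sum.lessThan_Suc_shift del: sum.lessThan_Suc)
qed

lemma independent_imp_F_independent:
  assumes "ring.independent R F_consts Us"
  shows "F_independent (length Us) (\<lambda>i. Us ! i)"
  unfolding F_independent_def
proof (intro allI impI)
  fix b i
  assume b: "(\<forall>i<length Us. b i \<in> F) \<and> (\<Sum>i<length Us. smult (b i) (Us ! i)) = 0" and i: "i < length Us"
  define Ks where "Ks = map (\<lambda>i. [:b i:]) [0..<length Us]"
  have "set Ks \<subseteq> F_consts"
    using b by (auto simp: Ks_def)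
  moreover have "ring.combine R Ks Us = \<zero>\<^bsub>R\<^esub>"
    using b by (simp add: combine_eq_sum Ks_def)
  ultimately have "set (take (length Us) Ks) \<subseteq> {\<zero>\<^bsub>R\<^esub>}"
    using ring.independent_imp_trivial_combine[OF ring_R subfield_F_consts assms] by blast
  moreover have "Ks ! i \<in> set (take (length Us) Ks)"
    using i by (simp add: Ks_def)
  ultimately have "Ks ! i \<in> {\<zero>\<^bsub>R\<^esub>}"
    by (rule subsetD)
  then show "b i = 0"
    using i by (simp add: Ks_def)
qed

text \<open>The dimension is defined by a definite description, hence meaningful only once some basis is
  known to exist. A bound on independent families provides one: an independent list of
  greatest length spans \<open>V\<close>.\<close>
lemma dim_over_fixed_basis:
  assumes V: "0 \<in> V" "\<And>x y. x \<in> V \<Longrightarrow> y \<in> V \<Longrightarrow> x + y \<in> V"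
    "\<And>a x. a \<in> F \<Longrightarrow> x \<in> V \<Longrightarrow> smult a x \<in> V"
    and bounded: "\<And>s w. F_independent s w \<Longrightarrow> (\<And>i. i < s \<Longrightarrow> w i \<in> V) \<Longrightarrow> s \<le> B"
  shows "\<exists>w. F_independent (dim_over_fixed \<sigma> V) w \<and> (\<forall>i<dim_over_fixed \<sigma> V. w i \<in> V)"
proof -
  interpret ring R by (rule ring_R)
  note K = subfield_F_consts
  define P where "P Us \<longleftrightarrow> independent F_consts Us \<and> set Us \<subseteq> V" for Us
  have len: "length Us \<le> B" if "P Us" for Us
    using that bounded[OF independent_imp_F_independent, of Us] nth_mem unfolding P_def by blast
  have "P []"
    by (simp add: P_def)
  then obtain Us where Us: "P Us" and max: "\<And>Us'. P Us' \<Longrightarrow> length Us' \<le> length Us"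
    using ex_has_greatest_nat[of P "[]" length "Suc B"] len by (auto simp: less_Suc_eq_le)
  have "Span F_consts Us = V"
  proof (intro equalityI subsetI)
    fix x assume "x \<in> Span F_consts Us"
    then obtain Ks where Ks: "set Ks \<subseteq> F_consts" "length Ks = length Us" "x = combine Ks Us"
      using Span_mem_iff_length_version[OF K, of Us x] by auto
    have "Ks ! i \<star> Us ! i \<in> V" if i: "i < length Us" for i
    proof -
      have "Ks ! i \<in> F_consts"
        using Ks(1,2) i by (metis nth_mem subsetD)
      moreover have "Us ! i \<in> V"
        using Us i by (auto simp: P_def)
      ultimately show ?thesis
        using V(3) by auto
    qed
    then have "(\<Sum>i<j. Ks ! i \<star> Us ! i) \<in> V" if "j \<le> length Us" for j
      using that by (induction j) (auto intro: V(1,2))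
    then show "x \<in> V"
      using Ks by (simp add: combine_eq_sum)
  next
    fix v assume v: "v \<in> V"
    show "v \<in> Span F_consts Us"
    proof (rule ccontr)
      assume "v \<notin> Span F_consts Us"
      then have "P (v # Us)"
        using Us v unfolding P_def by (auto intro!: li_Cons)
      from max[OF this] show False
        by simp
    qed
  qed
  then have "dimension (length Us) F_consts V"
    using dimensionI[OF K, of Us V] Us by (simp add: P_def)
  from dimI[OF K this] have dim: "dim_over_fixed \<sigma> V = length Us"
    by (simp add: dim_over_fixed_def over_def)
  show ?thesis
  proof (intro exI[of _ "\<lambda>i. Us ! i"] conjI allI impI)
    show "F_independent (dim_over_fixed \<sigma> V) (\<lambda>i. Us ! i)"
      using Us independent_imp_F_independent by (simp add: dim P_def)
    show "Us ! i \<in> V" if "i < dim_over_fixed \<sigma> V" for i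
      using that Us by (auto simp: dim P_def)
  qed
qed

end

section \<open>Generators over the centre\<close>

text \<open>\<open>f_0\<close> is the form in which \<open>gcrd(f, t) = 1\<close> is used, and \<open>f_dvd_h\<close> can be stated with ordinary
  divisibility because \<open>f\<close> has coefficients in \<open>F\<close>.\<close>
locale min_central_multiple = finite_order_automorphism +
  fixes f hh :: "'a poly"
  assumes f_F [simp]: "f \<in> F_polys" and f_monic: "lead_coeff f = 1" and f_pos: "degree f > 0"
    and f_0: "coeff f 0 \<noteq> 0"
    and hh_F: "hh \<in> F_polys" and hh_monic: "lead_coeff hh = 1"
    and f_dvd_h: "f dvd subst hh"
    and hh_min: "\<And>g. g \<in> F_polys \<Longrightarrow> lead_coeff g = 1 \<Longrightarrow> f dvd subst g \<Longrightarrow> degree hh \<le> degree g"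
begin

abbreviation "h \<equiv> subst hh"

lemma f_nz [simp]: "f \<noteq> 0" and hh_nz [simp]: "hh \<noteq> 0"
  using f_monic hh_monic by auto

lemma deg_hh_pos: "degree hh > 0"
  using dvd_imp_degree_le[OF f_dvd_h] f_pos by (cases "degree hh") auto

text \<open>When \<open>hh\<close> is irreducible this is linear independence of \<open>v 0, \<dots>, v (w - 1)\<close> in
  \<open>F[t] / (f)\<close> over the field \<open>F[x] / (hh)\<close>. Phrasing it with representatives avoids constructing
  that field.\<close>
definition independent_over_centre :: "nat \<Rightarrow> (nat \<Rightarrow> 'a poly) \<Rightarrow> bool" where
  "independent_over_centre w v \<longleftrightarrow> (\<forall>j<w. v j \<in> F_polys) \<and>
     (\<forall>u. (\<forall>j<w. u j \<in> F_polys) \<and> f dvd (\<Sum>j<w. subst (u j) * v j) \<longrightarrow> (\<forall>j<w. hh dvd u j))"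

text \<open>The elements \<open>t\<^sup>n\<^sup>i v\<^sub>j\<close> with \<open>i < deg hh\<close> are independent over \<open>F\<close> modulo \<open>f\<close>. If there were
  more than \<open>deg f\<close> of them, they would be dependent over \<open>K\<close>; as they are fixed by \<open>\<sigma>\<close>, the
  \<open>K\<close>-relations are \<open>\<sigma>\<close>-stable, and descent would give a relation over \<open>F\<close>.\<close>
lemma independent_over_centre_bound:
  assumes free: "independent_over_centre w v"
  shows "w * degree hh \<le> degree f"
proof (rule ccontr)
  assume not_le: "\<not> ?thesis"
  define e where "e = degree hh"
  define I where "I = {..<w} \<times> {..<e}"
  define b where "b = (\<lambda>(j, i). monom 1 (n * i) * v j)"
  define Z where "Z a \<longleftrightarrow> f dvd (\<Sum>x\<in>I. smult (a x) (b x))" for a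
  have bF: "b x \<in> F_polys" if "x \<in> I" for x
    using that free by (auto simp: I_def b_def independent_over_centre_def)
  have "finite I" "card {..<degree f} < card I"
    using not_le by (auto simp: I_def e_def)
  from exists_linear_relation[OF _ this, of "\<lambda>x r. coeff (b x mod f) r"] obtain a where
    a: "\<exists>x\<in>I. a x \<noteq> 0" "\<forall>r<degree f. (\<Sum>x\<in>I. a x * coeff (b x mod f) r) = 0"
    by auto
  have mod_eq: "(\<Sum>x\<in>I. smult (a x) (b x mod f)) = (\<Sum>x\<in>I. smult (a x) (b x)) mod f"
    by (induction I rule: infinite_finite_induct) (simp_all add: poly_mod_add_left mod_smult_left)
  have "(\<Sum>x\<in>I. smult (a x) (b x)) mod f = 0"
  proof (rule poly_eq_0_if_small[OF degree_mod_less[OF f_nz]])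
    show "coeff ((\<Sum>x\<in>I. smult (a x) (b x)) mod f) r = 0" if "r < degree f" for r
      using a(2) that by (simp add: coeff_sum flip: mod_eq)
  qed
  then have "Z a"
    by (auto simp: Z_def)
  have "\<exists>c. Z c \<and> (\<exists>x\<in>I. c x \<noteq> 0) \<and> (\<forall>x\<in>I. \<sigma> (c x) = c x)"
  proof (rule exists_fixed_vector[where I = I and Z = Z and a = a])
    show "Z (\<lambda>x. p x - q x)" if "Z p" "Z q" for p q
      using dvd_diff[OF that[unfolded Z_def]] by (simp add: Z_def smult_diff_left sum_subtractf)
    show "Z (\<lambda>x. c * p x)" if "Z p" for p c
      using dvd_smult[OF that[unfolded Z_def], of c]
      by (simp add: Z_def smult_sum_right)
    show "Z (\<lambda>x. \<sigma> (p x))" if "Z p" for p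
    proof -
      have coeffwise_sum: "coeffwise (sum g A) = (\<Sum>x\<in>A. coeffwise (g x))" for g and A :: "(nat \<times> nat) set"
        by (induction A rule: infinite_finite_induct) simp_all
      obtain y where "(\<Sum>x\<in>I. smult (p x) (b x)) = f * y"
        using \<open>Z p\<close> by (auto simp: Z_def)
      then have "coeffwise (\<Sum>x\<in>I. smult (p x) (b x)) = f * coeffwise y"
        using f_F by (simp add: F_polys_iff_coeffwise)
      moreover have "coeffwise (\<Sum>x\<in>I. smult (p x) (b x)) = (\<Sum>x\<in>I. smult (\<sigma> (p x)) (b x))"
        unfolding coeffwise_sum using bF
        by (intro sum.cong) (auto simp: map_poly_smult hom_mult F_polys_iff_coeffwise)
      ultimately show ?thesis
        by (simp add: Z_def)
    qed
  qed (use \<open>finite I\<close> \<open>Z a\<close> a(1) in simp_all)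
  then obtain c where c: "Z c" "\<exists>x\<in>I. c x \<noteq> 0" "\<forall>x\<in>I. c x \<in> F"
    by (auto simp: fixed_field_def)
  define u where "u j = (\<Sum>i<e. monom (c (j, i)) i)" for j
  have coeff_u: "coeff (u j) i = (if i < e then c (j, i) else 0)" for i j
    by (simp add: u_def coeff_sum)
  have uF: "u j \<in> F_polys" if "j < w" for j
    using c that by (auto simp: polys_over_iff coeff_u I_def)
  have "(\<Sum>j<w. subst (u j) * v j) = (\<Sum>j<w. \<Sum>i<e. smult (c (j, i)) (b (j, i)))"
    by (simp add: b_def u_def subst_sum subst_monom sum_distrib_right smult_monom
        flip: mult_smult_left)
  also have "\<dots> = (\<Sum>x\<in>I. smult (c x) (b x))"
    unfolding I_def by (simp add: sum.cartesian_product case_prod_unfold)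
  finally have "(\<Sum>x\<in>I. smult (c x) (b x)) = (\<Sum>j<w. subst (u j) * v j)" ..
  then have "\<forall>j<w. hh dvd u j"
    using free c(1) uF by (auto simp: Z_def independent_over_centre_def)
  moreover have "u j \<noteq> 0 \<Longrightarrow> degree (u j) < e" for j
    using coeff_u[of j "degree (u j)"] by (auto split: if_splits)
  ultimately have "u j = 0" if "j < w" for j
    using that dvd_imp_degree_le[of hh "u j"] by (force simp: e_def)
  then have "c (j, i) = 0" if "j < w" "i < e" for i j
    using that coeff_u[of j i] by simp
  with c(2) show False
    by (auto simp: I_def)
qed

text \<open>An independent family of greatest length \<open>w\<close> spans: adding \<open>x\<close> creates a relation in which the
  coefficient of \<open>x\<close> is invertible modulo \<open>hh\<close>.\<close>
lemma generators_over_centre: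
  assumes irr: "irreducible_elem (poly_ring_over F) hh"
  shows "\<exists>w v. w * degree hh \<le> degree f \<and> (\<forall>j<w. v j \<in> F_polys) \<and>
    (\<forall>x\<in>F_polys. \<exists>u. f dvd x - (\<Sum>j<w. subst (u j) * v j))"
proof -
  have "independent_over_centre 0 (\<lambda>_. 0)"
    by (simp add: independent_over_centre_def)
  moreover have "w \<le> degree f" if "\<exists>v. independent_over_centre w v" for w
    using that independent_over_centre_bound deg_hh_pos
    by (metis One_nat_def Suc_leI le_trans mult_le_mono2 mult.right_neutral)
  ultimately obtain w where w: "\<exists>v. independent_over_centre w v"
    and w_max: "\<And>w'. \<exists>v. independent_over_centre w' v \<Longrightarrow> w' \<le> w"
    using ex_has_greatest_nat[of "\<lambda>w. \<exists>v. independent_over_centre w v" 0 id "Suc (degree f)"]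
    by (auto simp: less_Suc_eq_le)
  then obtain v where v: "independent_over_centre w v"
    by blast
  have "\<exists>u. f dvd x - (\<Sum>j<w. subst (u j) * v j)" if x: "x \<in> F_polys" for x
  proof -
    have "\<not> independent_over_centre (Suc w) (v(w := x))"
      using w_max by (metis Suc_n_not_le_n)
    moreover have "(\<Sum>j<Suc w. subst (u j) * (v(w := x)) j) =
        (\<Sum>j<w. subst (u j) * v j) + subst (u w) * x" for u
      by simp
    ultimately obtain u j where u: "\<forall>j<Suc w. u j \<in> F_polys" "j < Suc w" "\<not> hh dvd u j"
      and dvd: "f dvd (\<Sum>j<w. subst (u j) * v j) + subst (u w) * x"
      using v x unfolding independent_over_centre_def by (auto simp: less_Suc_eq all_conj_distrib)
    have "\<not> hh dvd u w"
    proof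
      assume *: "hh dvd u w"
      then have "f dvd subst (u w) * x"
        using f_dvd_h by (elim dvdE) simp
      then have "f dvd (\<Sum>j<w. subst (u j) * v j)"
        using dvd by (metis dvd_add_left_iff)
      then show False
        using v u * unfolding independent_over_centre_def by (metis less_Suc_eq)
    qed
    then obtain a b where "a * u w + b * hh = 1"
      using F_bezout[OF irr] u by blast
    then have "subst (a * u w + b * hh) = 1"
      by simp
    then have "x = (subst a * subst (u w) + subst b * h) * x"
      by simp
    then have "x - (\<Sum>j<w. subst (- a * u j) * v j) =
        subst a * ((\<Sum>j<w. subst (u j) * v j) + subst (u w) * x) + h * (subst b * x)"
      by (simp add: algebra_simps sum_distrib_left sum_negf)
    also have "f dvd \<dots>"
      using dvd f_dvd_h by simp
    finally show ?thesis
      by (intro exI[of _ "\<lambda>j. - a * u j"])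
  qed
  with v independent_over_centre_bound[OF v] show ?thesis
    unfolding independent_over_centre_def by blast
qed

lemma h_F [simp]: "h \<in> F_polys"
  using hh_F by simp

lemma h_central: "h \<star> x = x \<star> h"
  by (simp add: mult.commute)

text \<open>In a domain the two factors of a central element commute.\<close>
lemma h_swap: "h = a \<star> b \<Longrightarrow> h = b \<star> a"
proof -
  assume h: "h = a \<star> b"
  then have "(b \<star> a) \<star> b = h \<star> b"
    using h_central[of b] by (simp only: skew_assoc)
  moreover have "b \<noteq> 0"
    using h by auto
  ultimately show ?thesis
    using skew_cancel_right by metis
qed

text \<open>Otherwise \<open>hh\<close> would be divisible by \<open>x\<close>, and \<open>t\<^sup>n\<close> could be cancelled from \<open>h\<close>, contradicting
  minimality.\<close>
lemma h_0: "coeff h 0 \<noteq> 0"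
proof
  assume "coeff h 0 = 0"
  then have hh: "poly_shift (Suc 0) hh * t = hh"
    using poly_split_0[of hh] by (simp add: coeff_subst)
  define y where "y = poly_shift (Suc 0) hh"
  have y: "hh = y * t" "y \<noteq> 0"
    using hh by (auto simp: y_def)
  then have "degree hh = degree y + 1" "lead_coeff y = 1"
    using hh_monic by (auto simp: degree_mult_eq degree_monom_eq coeff_times_t)
  moreover have "y \<in> F_polys"
    using hh_F by (auto simp: y_def polys_over_iff coeff_poly_shift)
  moreover have "h = t ^ n * subst y"
    by (simp add: y(1) subst_monom monom_power mult.commute)
  then have "f dvd subst y"
    using f_dvd_h f_0 t_dvd_cancel by metis
  ultimately show False
    using hh_min[of y] by simp
qed

text \<open>Modulo the central element \<open>h\<close>, whose constant coefficient is nonzero, \<open>t\<close> is invertible; the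
  formula makes the inverse explicit.\<close>
lemma unit_mod_h:
  obtains h' where "\<And>z. z = smult (inverse (coeff h 0)) (h \<star> z - h' \<star> (t \<star> z))"
    "h' \<in> F_polys"
proof
  have h': "poly_shift (Suc 0) h \<in> F_polys"
    using h_F by (auto simp: polys_over_iff coeff_poly_shift simp del: h_F)
  have "h \<star> z = smult (coeff h 0) z + poly_shift (Suc 0) h \<star> (t \<star> z)" for z
    by (subst poly_split_0[of h, symmetric])
      (simp only: skew_add_left const_skew skew_F_poly[OF t_F, symmetric] skew_assoc)
  then show "z = smult (inverse (coeff h 0)) (h \<star> z - poly_shift (Suc 0) h \<star> (t \<star> z))" for z
    using h_0 by simp
  show "poly_shift (Suc 0) h \<in> F_polys"
    by (rule h')
qed

text \<open>\<open>t\<close> acts injectively on \<open>R / R f\<close>, since \<open>h\<close>, whose constant coefficient is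
  nonzero, acts as \<open>0\<close>.\<close>
lemma t_cancel_left:
  assumes "f dvd t \<star> g"
  shows "f dvd g"
proof -
  obtain h' where "g = smult (inverse (coeff h 0)) (h \<star> g - h' \<star> (t \<star> g))"
    using unit_mod_h by metis
  moreover have "h \<star> g - h' \<star> (t \<star> g) \<in> left_multiples f"
    using assms f_dvd_h left_multiples_simps(3)[of "t \<star> g" f h'] left_multiples_simps(2)
    by (simp add: left_multiples_F_poly)
  ultimately show ?thesis
    by (metis f_F left_multiples_F_poly left_multiples_simps(4))
qed

text \<open>Right multiplication by \<open>g\<close> is well defined on \<open>R / R f\<close> as soon as it maps \<open>f\<close> to \<open>0\<close>.\<close>
lemma idealizer_mult:
  assumes "f dvd y" "f dvd f \<star> g"
  shows "f dvd y \<star> g"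
proof -
  obtain q where "y = q \<star> f"
    using assms(1) by (auto simp: dvd_def mult.commute)
  then have "y \<star> g = q \<star> (f \<star> g)"
    by (simp add: skew_assoc del: skew_F_poly)
  then show ?thesis
    using assms(2) left_multiples_simps(3)[of "f \<star> g" f q] by (simp add: left_multiples_F_poly)
qed

section \<open>The dimension of the idealizer\<close>

text \<open>The operator \<open>T a\<close> in the proof is the combination \<open>\<Sum> a\<^sub>i c\<^sub>i\<close> of right multiplications, with
  coefficients \<open>a\<^sub>i \<in> K\<close> acting from the left. It commutes with \<open>K\<close> and with \<open>t\<^sup>n\<close>, but not
  with \<open>t\<close>: moving \<open>t\<close> across it twists the \<open>a\<^sub>i\<close>, and this is what makes the space of
  vanishing combinations stable under \<open>\<sigma>\<^sup>-\<^sup>1\<close>.\<close>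
theorem idealizer_dimension_bound:
  assumes irr: "irreducible_elem (poly_ring_over F) hh"
    and fin: "finite I"
    and c: "\<And>i. i \<in> I \<Longrightarrow> degree (c i) < degree f" "\<And>i. i \<in> I \<Longrightarrow> f dvd f \<star> c i"
    and indep: "\<And>b. (\<And>i. i \<in> I \<Longrightarrow> b i \<in> F) \<Longrightarrow> (\<Sum>i\<in>I. smult (b i) (c i)) = 0 \<Longrightarrow>
      \<forall>i\<in>I. b i = 0"
  shows "card I * degree hh \<le> degree f ^ 2"
proof -
  obtain w v where w: "w * degree hh \<le> degree f" "\<forall>j<w. v j \<in> F_polys"
    and gen: "\<forall>x\<in>F_polys. \<exists>u. f dvd x - (\<Sum>j<w. subst (u j) * v j)"
    using generators_over_centre[OF irr] by blast
  define T where "T a x = (\<Sum>i\<in>I. smult (a i) (x \<star> c i))" for a x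
  have T_add: "T a (x + y) = T a x + T a y" for a x y
    by (simp add: T_def smult_add_right sum.distrib)
  have T_sum: "T a (sum g A) = (\<Sum>j\<in>A. T a (g j))" for a g and A :: "nat set"
    by (induction A rule: infinite_finite_induct) (simp_all add: T_add, simp_all add: T_def)
  have T_smult: "T a (smult k x) = smult k (T a x)" for a k x
    by (simp add: T_def smult_sum_right mult.commute)
  have T_subst: "T a (subst p * x) = subst p * T a x" for a p x
  proof -
    have "(subst p * x) \<star> y = subst p * (x \<star> y)" for y
      unfolding subst_skew[symmetric] by (rule skew_assoc)
    then show ?thesis
      by (simp add: T_def sum_distrib_left)
  qed
  have T_ideal: "f dvd T a y" if "f dvd y" for a y
    unfolding T_def by (rule dvd_sum) (intro dvd_smult idealizer_mult[OF that c(2)])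
  have "card I \<le> w * degree f"
  proof (rule ccontr)
    assume "\<not> ?thesis"
    then have "finite ({..<w} \<times> {..<degree f})" "card ({..<w} \<times> {..<degree f}) < card I"
      by simp_all
    from exists_linear_relation[OF this(1) fin this(2),
        of "\<lambda>i (j, r). coeff ((v j \<star> c i) mod f) r"]
    obtain a where a: "\<exists>i\<in>I. a i \<noteq> 0"
      "\<And>j r. j < w \<Longrightarrow> r < degree f \<Longrightarrow> (\<Sum>i\<in>I. a i * coeff ((v j \<star> c i) mod f) r) = 0"
      by auto
    \<comment> \<open>The relation \<open>a\<close> kills the generators, hence everything.\<close>
    have "f dvd T a (v j)" if "j < w" for j
    proof -
      have mod_eq: "T a (v j) mod f = (\<Sum>i\<in>I. smult (a i) ((v j \<star> c i) mod f))"
        unfolding T_def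
        by (induction I rule: infinite_finite_induct)
          (simp_all add: poly_mod_add_left mod_smult_left)
      have "T a (v j) mod f = 0"
      proof (rule poly_eq_0_if_small[OF degree_mod_less[OF f_nz]])
        show "coeff (T a (v j) mod f) r = 0" if "r < degree f" for r
          using a(2)[OF \<open>j < w\<close> that] by (simp add: mod_eq coeff_sum)
      qed
      then show ?thesis
        by auto
    qed
    then have "f dvd (\<Sum>j<w. subst (u j) * T a (v j))" for u
      by (intro dvd_sum) simp
    then have T_gen: "f dvd T a (\<Sum>j<w. subst (u j) * v j)" for u
      by (simp only: T_sum T_subst)
    have T_F: "f dvd T a x" if xF: "x \<in> F_polys" for x
    proof -
      obtain u where "f dvd x - (\<Sum>j<w. subst (u j) * v j)"
        using bspec[OF gen xF] by (elim exE)
      from dvd_add[OF T_ideal[OF this] T_gen]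
      have "f dvd T a (x - (\<Sum>j<w. subst (u j) * v j) + (\<Sum>j<w. subst (u j) * v j))"
        unfolding T_add .
      then show ?thesis
        by (simp only: diff_add_cancel)
    qed
    have "f dvd T a x" for x
    proof (induction x rule: poly_monom_induct)
      case (1 k i)
      have "monom k i = smult k (monom 1 i)"
        by (simp add: smult_monom)
      then show ?case
        using T_F[of "monom 1 i"] by (simp add: T_smult dvd_smult)
    qed (simp add: T_add)
    \<comment> \<open>Descent turns \<open>a\<close> into a relation over \<open>F\<close>, whose value at \<open>1\<close> is an ordinary \<open>F\<close>-linear
      combination of the \<open>c\<^sub>i\<close>.\<close>
    define Z where "Z b \<longleftrightarrow> (\<forall>x. f dvd T b x)" for b
    have "Z a"
      using \<open>\<And>x. f dvd T a x\<close> by (simp add: Z_def)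
    have "\<exists>b. Z b \<and> (\<exists>i\<in>I. b i \<noteq> 0) \<and> (\<forall>i\<in>I. \<tau> (b i) = b i)"
    proof (rule exists_fixed_vector[where I = I and Z = Z and a = a])
      show "Z (\<lambda>i. p i - q i)" if "Z p" "Z q" for p q
        using that by (simp add: Z_def T_def smult_diff_left sum_subtractf dvd_diff)
      show "Z (\<lambda>i. k * p i)" if "Z p" for p k
      proof -
        have "T (\<lambda>i. k * p i) x = smult k (T p x)" for x
          by (simp add: T_def smult_sum_right)
        then show ?thesis
          using that by (simp add: Z_def dvd_smult)
      qed
      show "Z (\<lambda>i. \<tau> (p i))" if "Z p" for p
      proof -
        have "t \<star> smult k y = smult (\<sigma> k) (t \<star> y)" for k y
          by (rule poly_eqI) (simp add: monom_skew hom_mult)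
        then have "t \<star> T (\<lambda>i. \<tau> (p i)) x = T p (t \<star> x)" for x
          by (simp add: T_def skew_sum_right skew_assoc)
        then show ?thesis
          using that t_cancel_left by (metis Z_def)
      qed
    qed (use fin \<open>Z a\<close> a(1) in simp_all)
    then obtain b where b: "Z b" "\<exists>i\<in>I. b i \<noteq> 0" "\<And>i. i \<in> I \<Longrightarrow> b i \<in> F"
      using F_I by metis
    have "f dvd (\<Sum>i\<in>I. smult (b i) (c i))"
      using b(1) unfolding Z_def T_def by (metis (no_types, lifting) one_skew sum.cong)
    moreover have "degree (\<Sum>i\<in>I. smult (b i) (c i)) < degree f"
      using c f_pos by (intro degree_sum_less) (auto intro: le_less_trans[OF degree_smult_le])
    ultimately have "(\<Sum>i\<in>I. smult (b i) (c i)) = 0"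
      by (meson dvd_imp_degree_le not_le)
    with indep b show False
      by blast
  qed
  then have "card I * degree hh \<le> w * degree f * degree hh"
    by simp
  also have "\<dots> \<le> degree f ^ 2"
    using w(1) by (simp add: power2_eq_square mult.commute mult.left_commute)
  finally show ?thesis .
qed

section \<open>Degrees of irreducible factors\<close>

text \<open>Right multiplication by \<open>g\<close> is a nonzero homomorphism from \<open>R / R p\<close> to \<open>R / R p'\<close>. If there
  is none, \<open>p\<close> acts injectively on \<open>R / R p'\<close>, so the complementary factor \<open>q\<close> of \<open>h = p q\<close>
  annihilates it. The annihilator \<open>A\<close> is a two-sided ideal from which \<open>t\<close> can be cancelled. Its
  element of least degree, scaled to constant coefficient \<open>1\<close>, is central, because its
  commutators with \<open>K\<close> and \<open>t\<close> lie in \<open>A\<close> and become too small after cancelling \<open>t\<close>. This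
  element is \<open>c(t\<^sup>n)\<close> with \<open>c\<close> of smaller degree than the irreducible \<open>hh\<close>, so \<open>c\<close> and \<open>hh\<close>
  generate the unit ideal, and \<open>1 \<in> A\<close>, although \<open>p'\<close> is not a unit.\<close>
lemma exists_intertwiner:
  assumes irr: "irreducible_elem (poly_ring_over F) hh"
    and p: "h \<in> left_multiples p" "degree p > 0"
    and p': "h \<in> left_multiples p'" "1 \<notin> left_multiples p'"
  shows "\<exists>g. g \<notin> left_multiples p' \<and> p \<star> g \<in> left_multiples p'"
proof (rule ccontr)
  assume none: "\<not> ?thesis"
  obtain q where q: "h = q \<star> p"
    using p by (auto simp: left_multiples_def)
  define A where "A = {y. \<forall>z. y \<star> z \<in> left_multiples p'}"
  have h_mult: "h \<star> z \<in> left_multiples p'" for z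
    using p' by (simp add: h_central del: subst_skew skew_F_poly)
  have "p \<star> (q \<star> z) \<in> left_multiples p'" for z
    using h_mult h_swap[OF q] by (metis skew_assoc)
  then have "q \<star> z \<in> left_multiples p'" for z
    using none by blast
  then have "q \<in> A"
    by (simp add: A_def)
  have A_diff: "x - y \<in> A" if "x \<in> A" "y \<in> A" for x y
    using that by (simp add: A_def)
  have A_left: "x \<star> y \<in> A" and A_right: "y \<star> x \<in> A" if "y \<in> A" for x y
    using that by (simp_all add: A_def skew_assoc)
  have "h \<in> A"
    using h_mult by (simp add: A_def)
  have A_t: "y \<in> A" if "y \<star> t \<in> A" for y
  proof -
    define k where "k = inverse (coeff h 0)"
    have k: "k \<in> F"
      using h_F unfolding polys_over_iff k_def by simp
    obtain h' where h': "\<And>z. z = smult k (h \<star> z - h' \<star> (t \<star> z))" "h' \<in> F_polys"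
      using unit_mod_h unfolding k_def by metis
    have "h' \<star> t = t \<star> h'"
      using h'(2) by (simp add: mult.commute)
    then have eq: "y \<star> z = smult k ((y \<star> h) \<star> z - (y \<star> t) \<star> (h' \<star> z))" for z
      using k by (subst h'(1)[of z]) (simp only: skew_smult_F skew_diff_right flip: skew_assoc)
    have "(y \<star> h) \<star> z \<in> left_multiples p'" "(y \<star> t) \<star> (h' \<star> z) \<in> left_multiples p'" for z
      using A_left[OF \<open>h \<in> A\<close>] that unfolding A_def by blast+
    then have "y \<star> z \<in> left_multiples p'" for z
      by (subst eq[of z]) (intro left_multiples_simps(2,4))
    then show ?thesis
      by (simp add: A_def)
  qed
  have "q \<noteq> 0" "p \<noteq> 0"
    using q by auto
  then have deg_q: "degree q < degree h"
    using q p(2) degree_skew[of q p] by simp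
  obtain g0 where g0: "g0 \<in> A" "g0 \<noteq> 0" and
    min: "\<And>x. x \<in> A \<Longrightarrow> x \<noteq> 0 \<Longrightarrow> degree g0 \<le> degree x"
    using ex_has_least_nat[of "\<lambda>x. x \<in> A \<and> x \<noteq> 0" q degree] \<open>q \<in> A\<close> \<open>q \<noteq> 0\<close> by blast
  \<comment> \<open>Minimality of \<open>g0\<close>: an element of \<open>A\<close> without constant term is \<open>y' t\<close> with \<open>y' \<in> A\<close> of smaller
    degree.\<close>
  have small: "y = 0" if y: "y \<in> A" "coeff y 0 = 0" "degree y \<le> degree g0" for y
  proof (rule ccontr)
    assume "y \<noteq> 0"
    define y' where "y' = poly_shift (Suc 0) y"
    have y': "y = y' * t"
      using poly_split_0[of y] y(2) by (simp add: y'_def)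
    then have "y' \<noteq> 0"
      using \<open>y \<noteq> 0\<close> by auto
    then have "degree y = degree y' + 1"
      by (simp add: y' degree_mult_eq degree_monom_eq)
    moreover have "y' \<in> A"
      using A_t y(1) y' by simp
    ultimately show False
      using min[OF _ \<open>y' \<noteq> 0\<close>] y(3) by fastforce
  qed
  define g where "g = smult (inverse (coeff g0 0)) g0"
  have "coeff g0 0 \<noteq> 0"
    using small g0 by auto
  then have g: "coeff g 0 = 1" "g \<noteq> 0" "degree g = degree g0"
    by (auto simp: g_def)
  have "g \<in> A"
    using A_left[OF g0(1), of "[:inverse (coeff g0 0):]"] by (simp add: g_def)
  have "n dvd k" if "coeff g k \<noteq> 0" for k
  proof -
    have "a * coeff g k = coeff g k * (\<sigma> ^^ k) a" for a
    proof -
      have "g \<star> [:a:] - [:a:] \<star> g = 0"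
      proof (rule small)
        show "g \<star> [:a:] - [:a:] \<star> g \<in> A"
          by (intro A_diff A_left A_right \<open>g \<in> A\<close>)
        show "degree (g \<star> [:a:] - [:a:] \<star> g) \<le> degree g0"
          using degree_skew_le[of g "[:a:]"] g(3) by (intro degree_diff_le) auto
      qed (simp add: g)
      then have "coeff (g \<star> [:a:]) k = coeff ([:a:] \<star> g) k"
        by simp
      then show ?thesis
        by (simp only: coeff_skew_const const_skew coeff_smult)
    qed
    then have "(\<sigma> ^^ k) a = a" for a
      using that by (metis mult.commute mult_cancel_left)
    then show ?thesis
      using pow_eq_id_iff[of k] by (auto simp: fun_eq_iff)
  qed
  moreover have "g \<in> F_polys"
  proof -
    have "g \<star> t - t \<star> g = (g - coeffwise g) \<star> t"
      unfolding t_skew by (simp add: left_diff_distrib)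
    then have "g - coeffwise g \<in> A"
      using A_t A_diff A_left A_right \<open>g \<in> A\<close> by metis
    then have "g - coeffwise g = 0"
      by (rule small) (use g in \<open>auto intro: degree_diff_le\<close>)
    then show ?thesis
      by (simp add: F_polys_iff_coeffwise)
  qed
  ultimately obtain c where c: "c \<in> F_polys" "g = subst c"
    using central_imp_subst by blast
  have "degree g < degree h"
    using min[OF \<open>q \<in> A\<close> \<open>q \<noteq> 0\<close>] deg_q g(3) by simp
  then have "degree c < degree hh"
    using c(2) by simp
  moreover have "c \<noteq> 0"
    using c g by auto
  ultimately have "\<not> hh dvd c"
    using dvd_imp_degree_le by (metis not_le)
  then obtain a b where "a * c + b * hh = 1"
    using F_bezout[OF irr c(1)] by blast
  then have "subst (a * c + b * hh) = 1"
    by simp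
  then have "subst a \<star> g - subst (- b) \<star> h = 1"
    unfolding c(2) by simp
  moreover have "subst a \<star> g - subst (- b) \<star> h \<in> A"
    by (intro A_diff A_left \<open>g \<in> A\<close> \<open>h \<in> A\<close>)
  ultimately have "1 \<star> 1 \<in> left_multiples p'"
    unfolding A_def by simp
  then show False
    using p'(2) by simp
qed

text \<open>A nonzero homomorphism out of the simple module \<open>R / R p\<close> is injective, so \<open>deg p\<close>, the
  dimension of \<open>R / R p\<close> over \<open>K\<close>, is at most that of the target.\<close>
lemma irreducible_factor_degree_le:
  assumes irr: "irreducible_elem (poly_ring_over F) hh"
    and p: "irreducible_elem R p" "h \<in> left_multiples p"
    and p': "irreducible_elem R p'" "h \<in> left_multiples p'"
  shows "degree p \<le> degree p'"
proof (rule ccontr)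
  assume less: "\<not> ?thesis"
  obtain g where g: "g \<notin> left_multiples p'" "p \<star> g \<in> left_multiples p'"
    using exists_intertwiner[OF irr p(2) irreducible_degree_pos[OF p(1)] p'(2)]
      irreducible_not_one[OF p'(1)] by blast
  define J where "J = {r. r \<star> g \<in> left_multiples p'}"
  have J: "J \<subseteq> left_multiples p"
    by (rule irreducible_left_ideal[OF p(1)]) (use g in \<open>simp_all add: J_def skew_assoc\<close>)
  have "p' \<noteq> 0"
    using p' by (simp add: irreducible_elem_def)
  then have "\<forall>i. \<exists>q r. monom 1 i \<star> g = q \<star> p' + r \<and> (r = 0 \<or> degree r < degree p')"
    using right_division by blast
  then obtain q r where qr: "\<And>i. monom 1 i \<star> g = q i \<star> p' + r i"
    "\<And>i. r i = 0 \<or> degree (r i) < degree p'"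
    by metis
  have "card {..<degree p'} < card {..<degree p}"
    using less by simp
  from exists_linear_relation[OF _ _ this, of "\<lambda>i. coeff (r i)"] obtain a where
    a: "\<exists>i<degree p. a i \<noteq> 0" "\<forall>x<degree p'. (\<Sum>i<degree p. a i * coeff (r i) x) = 0"
    by auto
  have "(\<Sum>i<degree p. smult (a i) (r i)) = 0"
  proof (rule poly_eqI)
    fix x
    have "x \<ge> degree p' \<Longrightarrow> coeff (r i) x = 0" for i
      using qr(2)[of i] by (auto simp: coeff_eq_0)
    then show "coeff (\<Sum>i<degree p. smult (a i) (r i)) x = coeff 0 x"
      using a(2) by (cases "x < degree p'") (simp_all add: coeff_sum)
  qed
  moreover define s where "s = (\<Sum>i<degree p. monom (a i) i)"
  have "monom (a i) i \<star> g = smult (a i) (monom 1 i \<star> g)" for i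
    by (simp add: smult_monom flip: skew_smult_left)
  then have "s \<star> g = (\<Sum>i<degree p. smult (a i) (q i \<star> p')) + (\<Sum>i<degree p. smult (a i) (r i))"
    by (simp add: s_def skew_sum_left qr(1) smult_add_right sum.distrib)
  ultimately have "s \<in> J"
    by (simp add: J_def left_multiples_sum left_multiplesI)
  then obtain y where y: "s = y \<star> p"
    using J by (auto simp: left_multiples_def)
  have coeff_s: "coeff s i = (if i < degree p then a i else 0)" for i
    by (simp add: s_def coeff_sum)
  then have "s \<noteq> 0"
    using a(1) by (metis coeff_0)
  then have "degree p \<le> degree s"
    using y degree_skew[of y p] by auto
  with coeff_s[of "degree s"] \<open>s \<noteq> 0\<close> show False
    by simp
qed

abbreviation skew_prod where "skew_prod gs \<equiv> foldr (\<lambda>a b. a \<star> b) gs 1"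

lemma skew_prod_factor: "g \<in> set gs \<Longrightarrow> \<exists>u b. skew_prod gs = u \<star> (g \<star> b)"
proof (induction gs)
  case (Cons a gs)
  show ?case
  proof (cases "g = a")
    case True
    then show ?thesis
      by (intro exI[of _ 1] exI[of _ "skew_prod gs"]) simp
  next
    case False
    with Cons obtain u b where "skew_prod gs = u \<star> (g \<star> b)"
      by auto
    then show ?thesis
      by (metis foldr_Cons comp_apply skew_assoc)
  qed
qed simp

lemma degree_skew_prod:
  "(\<And>g. g \<in> set gs \<Longrightarrow> g \<noteq> 0 \<and> degree g = r) \<Longrightarrow>
    skew_prod gs \<noteq> 0 \<and> degree (skew_prod gs) = length gs * r"
  by (induction gs) (simp_all add: degree_skew)

text \<open>Swapping factors of the central element \<open>h\<close> moves any factor to the right end.\<close>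
lemma factor_divides_h:
  assumes "h \<in> left_multiples (u \<star> (g \<star> b))"
  shows "h \<in> left_multiples g"
proof -
  obtain y where "h = y \<star> (u \<star> (g \<star> b))"
    using assms by (auto simp: left_multiples_def)
  then have "h = (y \<star> u) \<star> (g \<star> b)"
    by (simp add: skew_assoc)
  then have "h = g \<star> (b \<star> (y \<star> u))"
    using h_swap by (metis skew_assoc)
  then show ?thesis
    by (intro left_multiplesI) (rule h_swap)
qed

text \<open>If \<open>r\<close> is the common degree of all irreducible factors, then \<open>deg f = l r\<close> and
  \<open>n deg hh = deg h = k r\<close>; eliminating \<open>r\<close> gives the claim.\<close>
theorem factor_count:
  assumes irr: "irreducible_elem (poly_ring_over F) hh"
    and l: "num_irreducible_factors R f l" and k: "num_irreducible_factors R h k"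
  shows "k > 0" "k * degree f = l * (n * degree hh)"
proof -
  have h_f: "h \<in> left_multiples f"
    using f_dvd_h by (simp add: left_multiples_F_poly)
  obtain fs where fs: "length fs = l" "\<forall>g\<in>set fs. irreducible_elem R g" "skew_prod fs = f"
    using l by (auto simp: num_irreducible_factors_def)
  obtain hs where hs: "length hs = k" "\<forall>g\<in>set hs. irreducible_elem R g" "skew_prod hs = h"
    using k by (auto simp: num_irreducible_factors_def)
  have fs_h: "h \<in> left_multiples g" if "g \<in> set fs" for g
    using skew_prod_factor[OF that] factor_divides_h h_f fs(3) by metis
  have hs_h: "h \<in> left_multiples g" if "g \<in> set hs" for g
    using skew_prod_factor[OF that] factor_divides_h hs(3) left_multiples_simps(5) by metis
  have "fs \<noteq> []"
    using fs(3) f_pos by auto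
  then obtain p where p: "p \<in> set fs"
    by (meson last_in_set)
  define r where "r = degree p"
  have "g \<noteq> 0 \<and> degree g = r" if "g \<in> set fs \<union> set hs" for g
    using irreducible_factor_degree_le[OF irr] that p fs(2) hs(2) fs_h hs_h
    unfolding r_def by (metis R_simps(5) UnE irreducible_elem_def le_antisym)
  then have f_deg: "degree f = l * r" and h_deg: "degree h = k * r"
    using degree_skew_prod[of fs r] degree_skew_prod[of hs r] fs hs by auto
  then show "k * degree f = l * (n * degree hh)"
    by (simp add: algebra_simps)
  show "k > 0"
    using h_deg deg_hh_pos n_pos by (cases k) auto
qed

text \<open>If \<open>hh = a b\<close> with both degrees smaller, minimality of \<open>hh\<close> says that neither \<open>a(t\<^sup>n)\<close> nor
  \<open>b(t\<^sup>n)\<close> lies in \<open>R f\<close>. Then \<open>{x. x b(t\<^sup>n) \<in> R f}\<close> is a proper left ideal that contains \<open>f\<close> and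
  \<open>a(t\<^sup>n)\<close>, against maximality of \<open>R f\<close>.\<close>
theorem irreducible_imp_irreducible_hh:
  assumes irr: "irreducible_elem R f"
  shows "irreducible_elem (poly_ring_over F) hh"
proof -
  have unit: "a \<in> Units (poly_ring_over F)" if a: "a \<in> F_polys" "a \<noteq> 0" "degree a = 0" for a
  proof -
    obtain k where k: "a = [:k:]"
      using a(3) degree_eq_zeroE by blast
    have "coeff a 0 \<in> F"
      using a(1) by (simp only: polys_over_iff)
    then have "monom (inverse k) 0 \<in> F_polys"
      by (intro F_polys_simps(8) F_simps(7)) (simp add: k)
    moreover have "monom (inverse k) 0 * a = 1"
      using a(2) by (simp add: k monom_0 one_pCons)
    ultimately show ?thesis
      using a(1) unfolding unit_poly_ring_over_iff by blast
  qed
  have not_dvd: "\<not> f dvd subst a" if a: "a \<in> F_polys" "a \<noteq> 0" "degree a < degree hh" for a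
  proof
    assume *: "f dvd subst a"
    define a' where "a' = smult (inverse (lead_coeff a)) a"
    have "inverse (lead_coeff a) \<in> F"
      using a(1) by (simp add: polys_over_iff)
    then have "a' \<in> F_polys" "lead_coeff a' = 1" "f dvd subst a'" "degree a' = degree a"
      using a * by (simp_all add: a'_def dvd_smult)
    with hh_min[of a'] a(3) show False
      by simp
  qed
  have "hh \<notin> Units (poly_ring_over F)"
  proof
    assume "hh \<in> Units (poly_ring_over F)"
    then obtain v where "v * hh = 1"
      by (auto simp: unit_poly_ring_over_iff)
    then have "degree hh = 0"
      by (metis degree_1 dvd_imp_degree_le dvd_triv_right le_zero_eq one_neq_zero)
    with deg_hh_pos show False
      by simp
  qed
  moreover have "a \<in> Units (poly_ring_over F) \<or> b \<in> Units (poly_ring_over F)"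
    if ab: "a \<in> F_polys" "b \<in> F_polys" "hh = a * b" for a b
  proof (rule ccontr)
    assume not_unit: "\<not> ?thesis"
    have nz: "a \<noteq> 0" "b \<noteq> 0"
      using ab(3) hh_nz by auto
    then have "degree a > 0" "degree b > 0"
      using unit not_unit ab by blast+
    then have "degree a < degree hh" "degree b < degree hh"
      using ab(3) nz by (auto simp: degree_mult_eq)
    then have nd: "\<not> f dvd subst a" "\<not> f dvd subst b"
      using not_dvd ab nz by blast+
    define J where "J = {x. x \<star> subst b \<in> left_multiples f}"
    have "J \<subseteq> left_multiples f"
    proof (rule irreducible_left_ideal[OF irr])
      show "f \<in> J"
        using ab by (simp add: J_def left_multiples_F_poly)
      show "x - y \<in> J" if "x \<in> J" "y \<in> J" for x y
        using that unfolding J_def by (simp only: skew_diff_left left_multiples_simps mem_Collect_eq)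
      show "q \<star> x \<in> J" if "x \<in> J" for q x
        using that unfolding J_def by (simp only: skew_assoc left_multiples_simps mem_Collect_eq)
      show "1 \<notin> J"
        using nd by (simp add: J_def left_multiples_F_poly)
    qed
    moreover have "subst a \<in> J"
      using f_dvd_h ab by (simp add: J_def left_multiples_F_poly)
    ultimately show False
      using nd by (auto simp: left_multiples_F_poly)
  qed
  ultimately show ?thesis
    using hh_F by (simp add: irreducible_elem_def)
qed

section \<open>The nuclei of the Petit algebra\<close>

abbreviation "S \<equiv> petit_algebra UNIV \<sigma> f"

lemma right_rem_eq_mod: "right_rem UNIV \<sigma> g f = g mod f"
  unfolding right_rem_def
proof (rule the_equality)
  have "degree (g mod f) < degree f"
    using degree_mod_less[OF f_nz, of g] f_pos by auto
  then show "g mod f \<in> polys_over UNIV \<and> degree (g mod f) < degree f \<and>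
      (\<exists>q\<in>polys_over UNIV. g = q \<star> f + g mod f)"
    by (intro conjI bexI[of _ "g div f"]) simp_all
next
  fix r assume r: "r \<in> polys_over UNIV \<and> degree r < degree f \<and> (\<exists>q\<in>polys_over UNIV. g = q \<star> f + r)"
  then obtain q where "g = q \<star> f + r"
    by blast
  then have "g mod f = (q * f + r) mod f"
    by simp
  also have "\<dots> = r"
    using r by (simp add: mod_poly_less)
  finally show "r = g mod f" ..
qed

lemma S_simps [simp]:
  "g \<in> carrier S \<longleftrightarrow> degree g < degree f" "g \<otimes>\<^bsub>S\<^esub> g' = (g \<star> g') mod f"
  by (simp_all add: petit_algebra_def right_rem_eq_mod)

lemma skew_multiple: "f dvd x \<Longrightarrow> f dvd y \<star> x"
  using left_multiples_simps(3)[of x f y] by (simp add: left_multiples_F_poly)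

text \<open>With \<open>q\<close> the quotient of \<open>x y\<close> by \<open>f\<close>, the associator of \<open>x, y, z\<close> is \<open>- q f z\<close> modulo \<open>R f\<close>:
  the other reduction, of \<open>y z\<close>, only contributes left multiples of \<open>f\<close>.\<close>
lemma associator_iff:
  "(x \<otimes>\<^bsub>S\<^esub> y) \<otimes>\<^bsub>S\<^esub> z = x \<otimes>\<^bsub>S\<^esub> (y \<otimes>\<^bsub>S\<^esub> z) \<longleftrightarrow> f dvd ((x \<star> y) div f) \<star> (f \<star> z)"
proof -
  define q where "q = (x \<star> y) div f"
  define q' where "q' = (y \<star> z) div f"
  have q: "(x \<star> y) mod f = x \<star> y - q \<star> f" and q': "(y \<star> z) mod f = y \<star> z - q' \<star> f"
    by (simp_all add: q_def q'_def minus_div_mult_eq_mod)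
  have "((x \<star> y) mod f) \<star> z - x \<star> ((y \<star> z) mod f) = x \<star> (q' \<star> f) - q \<star> (f \<star> z)"
    unfolding q q' by (simp only: skew_diff_left skew_diff_right skew_assoc) (simp add: algebra_simps)
  moreover have "f dvd x \<star> (q' \<star> f)"
    by (rule skew_multiple) simp
  ultimately show ?thesis
    unfolding S_simps mod_eq_dvd_iff q_def by (metis dvd_diff_right_iff)
qed

lemma div_f_small: "degree p < degree f \<Longrightarrow> p div f = 0"
  by (rule div_poly_less)

lemma div_f_same_degree:
  assumes "degree p = degree f"
  shows "p div f = [:lead_coeff p:]"
proof -
  define r where "r = p - smult (lead_coeff p) f"
  have r: "p = r + [:lead_coeff p:] * f"
    by (simp add: r_def)
  have "degree r < degree f"
  proof (rule ccontr)
    assume "\<not> ?thesis"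
    moreover have "degree r \<le> degree f"
      unfolding r_def using assms by (intro degree_diff_le) (auto intro: degree_smult_le[THEN le_trans])
    ultimately have "degree r = degree f"
      by simp
    moreover have "coeff r (degree f) = 0"
      using assms f_monic by (simp add: r_def)
    ultimately have "r = 0"
      by (metis leading_coeff_0_iff)
    with \<open>degree r = degree f\<close> f_pos show False
      by simp
  qed
  then have "r div f = 0"
    by (rule div_f_small)
  then have "(r + [:lead_coeff p:] * f) div f = [:lead_coeff p:]"
    by (subst div_mult_self1) (use f_nz in simp_all)
  then show ?thesis
    using r by simp
qed

text \<open>Representatives of the idealizer of \<open>R f\<close> modulo \<open>R f\<close>, also called the eigenring of \<open>f\<close>.\<close>
definition idealizer where "idealizer = {g. degree g < degree f \<and> f dvd f \<star> g}"

text \<open>The constants of the idealizer, as elements of \<open>K\<close>; \<open>nuc_eq\<close> identifies them with the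
  nucleus.\<close>
definition N_field where "N_field = {a. f dvd f \<star> [:a:]}"

text \<open>Necessity is tested on \<open>t\<close> and \<open>t\<^sup>m\<^sup>-\<^sup>1\<close>, whose product has quotient \<open>1\<close> by \<open>f\<close>; both have degree
  less than \<open>m = deg f\<close> because \<open>m \<ge> 2\<close>.\<close>
lemma nuc_right_eq:
  assumes "degree f \<ge> 2"
  shows "nuc_right S = idealizer"
proof (intro equalityI subsetI)
  fix x assume x: "x \<in> nuc_right S"
  define z where "z = (monom 1 (degree f - 1) :: 'a poly)"
  have tz: "t \<star> z = monom 1 (degree f)"
    using f_pos by (simp add: z_def monom_skew_monom)
  have "t \<in> carrier S" "z \<in> carrier S"
    using assms by (auto simp: z_def degree_monom_eq)
  then have "f dvd ((t \<star> z) div f) \<star> (f \<star> x)"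
    using x associator_iff[of t z x] unfolding nuc_right_def by blast
  moreover have "(t \<star> z) div f = [:1:]"
    unfolding tz by (subst div_f_same_degree) (simp_all add: degree_monom_eq)
  ultimately have "f dvd f \<star> x"
    by simp
  with x show "x \<in> idealizer"
    by (simp add: nuc_right_def idealizer_def)
next
  fix x assume "x \<in> idealizer"
  then show "x \<in> nuc_right S"
    unfolding nuc_right_def idealizer_def using associator_iff skew_multiple by simp
qed

text \<open>If \<open>x\<close> has positive degree, some power \<open>y\<close> of \<open>t\<close> in \<open>S\<close> makes \<open>x y\<close> have the degree of \<open>f\<close>, so the
  quotient of \<open>x y\<close> by \<open>f\<close> is a unit. Vanishing of the associators of \<open>x, y, z\<close> then says
  \<open>f z \<in> R f\<close> for all \<open>z\<close>, that is, \<open>f\<close> is right invariant.\<close>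
lemma nuc_left_const:
  assumes x: "x \<in> nuc_left S" and not_inv: "\<not> right_invariant R f"
  shows "degree x = 0"
proof (rule ccontr)
  assume d: "degree x \<noteq> 0"
  have dx: "degree x < degree f"
    using x by (simp add: nuc_left_def)
  define y where "y = (monom 1 (degree f - degree x) :: 'a poly)"
  have y: "x \<star> y = x * y"
    by (simp add: y_def)
  have "x \<noteq> 0"
    using d by auto
  then have deg: "degree (x \<star> y) = degree f"
    unfolding y using dx by (simp add: y_def degree_mult_eq degree_monom_eq)
  have lead: "lead_coeff (x \<star> y) = lead_coeff x"
    unfolding y by (simp add: lead_coeff_mult) (simp add: y_def degree_monom_eq)
  have "y \<in> carrier S"
    using d dx by (simp add: y_def degree_monom_eq)
  then have "f dvd ((x \<star> y) div f) \<star> (f \<star> z)" if "degree z < degree f" for z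
    using x that associator_iff[of x y z] unfolding nuc_left_def by simp
  then have small: "f dvd f \<star> z" if "degree z < degree f" for z
    using that \<open>x \<noteq> 0\<close> unfolding div_f_same_degree[OF deg] lead
    by (simp add: dvd_smult_iff)
  have all: "f dvd f \<star> z" for z
  proof -
    have "f \<star> z = f \<star> ((z div f) \<star> f) + f \<star> (z mod f)"
      by (simp flip: skew_add_right)
    moreover have "f dvd f \<star> (z mod f)"
      using small degree_mod_less[OF f_nz, of z] f_pos by auto
    moreover have "f dvd f \<star> ((z div f) \<star> f)"
      by (rule skew_multiple) simp
    ultimately show ?thesis
      by simp
  qed
  have "left_ideal_of R f = {g. f dvd g}"
    by (auto simp: left_ideal_of_def dvd_def mult.commute)
  moreover have "ideal {g. f dvd g} R"
  proof (rule idealI[OF ring_R])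
    interpret ring R by (rule ring_R)
    have minus: "\<ominus>\<^bsub>R\<^esub> x = - x" for x
      by (rule minus_equality) simp_all
    show "subgroup {g. f dvd g} (add_monoid R)"
      by (rule add.subgroupI) (auto simp: minus simp flip: a_inv_def)
    show "x \<otimes>\<^bsub>R\<^esub> a \<in> {g. f dvd g}" if "a \<in> {g. f dvd g}" for a x
      using that skew_multiple by simp
    show "a \<otimes>\<^bsub>R\<^esub> x \<in> {g. f dvd g}" if "a \<in> {g. f dvd g}" for a x
      using that idealizer_mult all by simp
  qed
  ultimately show False
    using not_inv by (simp add: right_invariant_def)
qed

text \<open>Products with a constant need no reduction modulo \<open>f\<close>, so every constant is in the left and in
  the middle nucleus.\<close>
lemma nuc_eq:
  assumes "degree f \<ge> 2" and not_inv: "\<not> right_invariant R f"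
  shows "nuc S = (\<lambda>a. [:a:]) ` N_field"
proof (intro equalityI subsetI)
  fix x assume x: "x \<in> nuc S"
  then have "degree x = 0"
    using nuc_left_const[OF _ not_inv] by (simp add: nuc_def)
  then obtain a where "x = [:a:]"
    using degree_eq_zeroE by blast
  moreover have "x \<in> idealizer"
    using x nuc_right_eq[OF assms(1)] by (simp add: nuc_def)
  ultimately show "x \<in> (\<lambda>a. [:a:]) ` N_field"
    by (simp add: N_field_def idealizer_def)
next
  fix x assume "x \<in> (\<lambda>a. [:a:]) ` N_field"
  then obtain a where x: "x = [:a:]" "f dvd f \<star> [:a:]"
    by (auto simp: N_field_def)
  have left: "(x \<star> y) div f = 0" and middle: "(y \<star> x) div f = 0" if "degree y < degree f" for y
    using that degree_skew_le[of x y] degree_skew_le[of y x] unfolding x(1)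
    by (auto intro!: div_f_small elim: le_less_trans)
  have "x \<in> carrier S"
    using f_pos by (simp add: x)
  moreover have "(x \<otimes>\<^bsub>S\<^esub> y) \<otimes>\<^bsub>S\<^esub> z = x \<otimes>\<^bsub>S\<^esub> (y \<otimes>\<^bsub>S\<^esub> z)"
    "(y \<otimes>\<^bsub>S\<^esub> x) \<otimes>\<^bsub>S\<^esub> z = y \<otimes>\<^bsub>S\<^esub> (x \<otimes>\<^bsub>S\<^esub> z)" if "y \<in> carrier S" for y z
    using that left middle unfolding associator_iff by simp_all
  ultimately have "x \<in> nuc_left S" "x \<in> nuc_middle S"
    unfolding nuc_left_def nuc_middle_def by blast+
  moreover have "x \<in> nuc_right S"
    using \<open>x \<in> carrier S\<close> x by (simp add: nuc_right_eq[OF assms(1)] idealizer_def)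
  ultimately show "x \<in> nuc S"
    by (simp add: nuc_def)
qed

lemma N_field_simps [simp]:
  "0 \<in> N_field" "a \<in> N_field \<Longrightarrow> b \<in> N_field \<Longrightarrow> a + b \<in> N_field"
  "c \<in> F \<Longrightarrow> a \<in> N_field \<Longrightarrow> c * a \<in> N_field"
proof -
  show "a \<in> N_field \<Longrightarrow> b \<in> N_field \<Longrightarrow> a + b \<in> N_field"
    using skew_add_right[of f "[:a:]" "[:b:]"] by (simp add: N_field_def)
  show "c \<in> F \<Longrightarrow> a \<in> N_field \<Longrightarrow> c * a \<in> N_field"
    using skew_smult_F[of c f "[:a:]"] by (simp add: N_field_def dvd_smult)
qed (simp add: N_field_def)

lemma N_field_sum: "(\<And>i. i \<in> A \<Longrightarrow> g i \<in> N_field) \<Longrightarrow> sum g A \<in> N_field"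
  by (induction A rule: infinite_finite_induct) simp_all

lemma monom_idealizer:
  assumes "a \<in> N_field"
  shows "f dvd f \<star> monom a j"
proof -
  have "monom a j = [:a:] \<star> monom 1 j"
    by (simp add: smult_monom)
  then have "f \<star> monom a j = (f \<star> [:a:]) \<star> monom 1 j"
    by (simp only: skew_assoc)
  also have "f dvd \<dots>"
    by (rule idealizer_mult) (use assms in \<open>simp_all add: N_field_def\<close>)
  finally show ?thesis .
qed

text \<open>The dimension bound for the idealizer, applied to constants, is what guarantees that the nucleus
  is finite-dimensional over \<open>F\<close>.\<close>
theorem nucleus_basis:
  assumes irr: "irreducible_elem (poly_ring_over F) hh"
    and "degree f \<ge> 2" and not_inv: "\<not> right_invariant R f"
  defines "s \<equiv> dim_over_fixed \<sigma> (nuc S)"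
  shows "\<exists>\<nu>. (\<forall>i<s. \<nu> i \<in> N_field) \<and>
    (\<forall>b. (\<forall>i<s. b i \<in> F) \<and> (\<Sum>i<s. b i * \<nu> i) = 0 \<longrightarrow> (\<forall>i<s. b i = 0))"
proof -
  note nuc = nuc_eq[OF assms(2,3)]
  have bound: "r \<le> degree f ^ 2" if indep: "F_independent r w" and w: "\<And>i. i < r \<Longrightarrow> w i \<in> nuc S" for r w
  proof -
    have "card {..<r} * degree hh \<le> degree f ^ 2"
    proof (rule idealizer_dimension_bound[OF irr, of _ w])
      show "degree (w i) < degree f" "f dvd f \<star> w i" if "i \<in> {..<r}" for i
        using that w[of i] f_pos by (auto simp: nuc N_field_def)
      show "\<forall>i\<in>{..<r}. b i = 0"
        if "\<And>i. i \<in> {..<r} \<Longrightarrow> b i \<in> F" "(\<Sum>i\<in>{..<r}. smult (b i) (w i)) = 0" for b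
        using that indep by (auto simp: F_independent_def)
    qed simp
    then have "r * degree hh \<le> degree f ^ 2"
      by simp
    moreover have "r \<le> r * degree hh"
      using deg_hh_pos by (cases "degree hh") simp_all
    ultimately show ?thesis
      by (rule order_trans[rotated])
  qed
  have zero: "0 \<in> nuc S"
    unfolding nuc by (rule image_eqI[of _ _ 0]) simp_all
  have add: "x + y \<in> nuc S" if "x \<in> nuc S" "y \<in> nuc S" for x y
    using that unfolding nuc by (elim imageE) (simp add: image_iff)
  have smult: "smult a x \<in> nuc S" if "a \<in> F" "x \<in> nuc S" for a x
    using that unfolding nuc by (elim imageE) (simp add: image_iff)
  have "\<exists>w. F_independent s w \<and> (\<forall>i<s. w i \<in> nuc S)"
    unfolding s_def by (rule dim_over_fixed_basis) (fact zero add smult bound)+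
  then obtain w where w: "F_independent s w" "\<And>i. i < s \<Longrightarrow> w i \<in> nuc S"
    by blast
  define \<nu> where "\<nu> i = coeff (w i) 0" for i
  have \<nu>: "w i = [:\<nu> i:]" "\<nu> i \<in> N_field" if "i < s" for i
    using w(2)[OF that] by (auto simp: nuc \<nu>_def)
  show ?thesis
  proof (intro exI[of _ \<nu>] conjI allI impI)
    fix b i
    assume b: "(\<forall>i<s. b i \<in> F) \<and> (\<Sum>i<s. b i * \<nu> i) = 0" and "i < s"
    have "(\<Sum>i<s. smult (b i) (w i)) = (\<Sum>i<s. monom (b i * \<nu> i) 0)"
      by (intro sum.cong) (simp_all add: \<nu> monom_0)
    also have "\<dots> = 0"
      using b by (simp flip: monom_sum)
    finally show "b i = 0"
      using w(1) b \<open>i < s\<close> by (simp add: F_independent_def)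
  qed (simp add: \<nu>)
qed

text \<open>The elements \<open>\<nu>\<^sub>i t\<^sup>j\<close>, where the \<open>\<nu>\<^sub>i\<close> are a basis of the nucleus and \<open>j < deg f\<close>, are
  \<open>s deg f\<close> independent elements of the idealizer. When equality holds in the first claim, this
  already is the maximal number of independent elements, so the idealizer has no others.\<close>
theorem nucleus_dimension:
  assumes irr: "irreducible_elem (poly_ring_over F) hh"
    and "degree f \<ge> 2" and not_inv: "\<not> right_invariant R f"
  defines "s \<equiv> dim_over_fixed \<sigma> (nuc S)"
  shows "s * degree hh \<le> degree f"
    and "s * degree hh = degree f \<Longrightarrow> idealizer = {g. degree g < degree f \<and> (\<forall>i. coeff g i \<in> N_field)}"
proof -
  obtain \<nu> where \<nu>: "\<And>i. i < s \<Longrightarrow> \<nu> i \<in> N_field" and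
    \<nu>_indep: "\<And>b. (\<And>i. i < s \<Longrightarrow> b i \<in> F) \<Longrightarrow> (\<Sum>i<s. b i * \<nu> i) = 0 \<Longrightarrow> \<forall>i<s. b i = 0"
    using nucleus_basis[OF assms(1-3)] unfolding s_def by blast
  define m where "m = degree f"
  define I where "I = {..<s} \<times> {..<m}"
  define c where "c = (\<lambda>(i, j). monom (\<nu> i) j)"
  have fin: "finite I" and card: "card I = s * m"
    by (simp_all add: I_def)
  have c: "degree (c x) < degree f" "f dvd f \<star> c x" if "x \<in> I" for x
    using that \<nu> monom_idealizer f_pos
    by (auto simp: I_def c_def m_def intro: degree_monom_le[THEN le_less_trans])
  have coeff_comb: "coeff (\<Sum>x\<in>I. smult (b x) (c x)) j =
      (if j < m then \<Sum>i<s. b (i, j) * \<nu> i else 0)" for b j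
  proof -
    have "(\<Sum>x\<in>I. smult (b x) (c x)) = (\<Sum>i<s. \<Sum>j<m. monom (b (i, j) * \<nu> i) j)"
      unfolding I_def by (simp add: c_def smult_monom sum.cartesian_product case_prod_unfold)
    then show ?thesis
      by (simp add: coeff_sum)
  qed
  have indep: "\<forall>x\<in>I. b x = 0"
    if b: "\<And>x. x \<in> I \<Longrightarrow> b x \<in> F" "(\<Sum>x\<in>I. smult (b x) (c x)) = 0" for b
  proof
    fix x assume "x \<in> I"
    then obtain i j where x: "x = (i, j)" "i < s" "j < m"
      by (auto simp: I_def)
    have "coeff (\<Sum>x\<in>I. smult (b x) (c x)) j = 0"
      unfolding b(2) by simp
    then have "(\<Sum>i<s. b (i, j) * \<nu> i) = 0"
      unfolding coeff_comb using x(3) by simp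
    moreover have "b (i, j) \<in> F" if "i < s" for i
      using b(1)[of "(i, j)"] that x(3) by (simp add: I_def)
    ultimately have "\<forall>i<s. b (i, j) = 0"
      by (intro \<nu>_indep)
    then show "b x = 0"
      using x by simp
  qed
  have "card I * degree hh \<le> degree f ^ 2"
    by (rule idealizer_dimension_bound[OF irr fin c indep])
  then have "m * (s * degree hh) \<le> m * m"
    unfolding card m_def power2_eq_square by (simp add: mult.commute mult.left_commute)
  then show "s * degree hh \<le> degree f"
    using f_pos by (simp add: m_def)
  show "idealizer = {g. degree g < degree f \<and> (\<forall>i. coeff g i \<in> N_field)}"
    if eq: "s * degree hh = degree f"
  proof (intro equalityI subsetI)
    fix g assume "g \<in> {g. degree g < degree f \<and> (\<forall>i. coeff g i \<in> N_field)}"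
    then have g: "degree g < degree f" "\<And>i. coeff g i \<in> N_field"
      by auto
    have "f \<star> g = (\<Sum>i\<le>degree g. f \<star> monom (coeff g i) i)"
      by (simp add: poly_as_sum_of_monoms flip: skew_sum_right)
    also have "f dvd \<dots>"
      by (intro dvd_sum monom_idealizer g)
    finally show "g \<in> idealizer"
      using g by (simp add: idealizer_def)
  next
    fix g assume g: "g \<in> idealizer"
    show "g \<in> {g. degree g < degree f \<and> (\<forall>i. coeff g i \<in> N_field)}"
    proof (rule ccontr)
      assume not_in: "\<not> ?thesis"
      \<comment> \<open>An index outside \<open>I\<close>, for the additional element \<open>g\<close>.\<close>
      define y where "y = (s, 0 :: nat)"
      have y: "y \<notin> I"
        by (simp add: y_def I_def)
      define c' where "c' = c(y := g)"
      have sum': "(\<Sum>x\<in>insert y I. smult (b x) (c' x)) = smult (b y) g + (\<Sum>x\<in>I. smult (b x) (c x))" for b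
        using y fin by (simp add: c'_def) (intro sum.cong, auto)
      have "card (insert y I) * degree hh \<le> degree f ^ 2"
      proof (rule idealizer_dimension_bound[OF irr, of _ c'])
        show "degree (c' x) < degree f" "f dvd f \<star> c' x" if "x \<in> insert y I" for x
          using that c[of x] g by (cases "x = y"; simp add: c'_def idealizer_def)+
        show "\<forall>x\<in>insert y I. b x = 0"
          if b: "\<And>x. x \<in> insert y I \<Longrightarrow> b x \<in> F" "(\<Sum>x\<in>insert y I. smult (b x) (c' x)) = 0" for b
        proof (cases "b y = 0")
          case True
          have "(\<Sum>x\<in>I. smult (b x) (c x)) = 0"
            using b(2) True unfolding sum' by simp
          then have "\<forall>x\<in>I. b x = 0"
            by (rule indep[rotated]) (rule b(1), simp)
          with True show ?thesis
            by simp
        next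
          case False
          define e where "e j = (if j < m then \<Sum>i<s. b (i, j) * \<nu> i else 0)" for j
          have e_N: "e j \<in> N_field" for j
          proof (cases "j < m")
            case True
            have "b (i, j) \<in> F" if "i < s" for i
              using b(1)[of "(i, j)"] that True by (simp add: I_def)
            then show ?thesis
              unfolding e_def using \<nu> by (auto intro!: N_field_sum N_field_simps(3))
          qed (simp add: e_def)
          have "coeff g j \<in> N_field" for j
          proof -
            have "coeff (smult (b y) g + (\<Sum>x\<in>I. smult (b x) (c x))) j = 0"
              using b(2) unfolding sum' by simp
            then have "b y * coeff g j + e j = 0"
              unfolding coeff_add coeff_smult coeff_comb e_def .
            then have "b y * coeff g j = - e j"
              by (simp only: eq_neg_iff_add_eq_0)
            then have "inverse (b y) * (b y * coeff g j) = - inverse (b y) * e j"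
              by simp
            moreover have "inverse (b y) * (b y * coeff g j) = coeff g j"
              using False by simp
            moreover have "- inverse (b y) * e j \<in> N_field"
              using b(1)[of y] e_N by (intro N_field_simps(3)) simp_all
            ultimately show ?thesis
              by (simp only:)
          qed
          with not_in g show ?thesis
            by (simp add: idealizer_def)
        qed
      qed (use fin in simp)
      then have "(s * m + 1) * degree hh \<le> m * m"
        using y fin card by (simp add: m_def power2_eq_square)
      moreover have "m * m = s * m * degree hh"
        using eq unfolding m_def by (metis mult.assoc mult.commute)
      ultimately show False
        using deg_hh_pos by simp
    qed
  qed
qed

end

section \<open>The nucleus and the factorizations of f and h\<close>

theorem corollary22:
  fixes \<sigma> :: "'a::field \<Rightarrow> 'a"
    and f hh h :: "'a poly"
    and R S :: "'a poly ring"
    and F :: "'a set"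
    and N :: "'a poly set"
    and n m l k :: nat
  assumes aut: "\<sigma> \<in> ring_iso (ring_of_type_algebra :: 'a ring) ring_of_type_algebra"
    and order: "has_order \<sigma> n" "n > 1"
    and F_def: "F = fixed_field \<sigma>"
    and R_def: "R = skew_poly_ring UNIV \<sigma>"
    and f_coeffs: "f \<in> polys_over F"
    and f_monic: "lead_coeff f = 1"
    and f_degree: "degree f = m" "m \<ge> 2"
    and f_bounded: "bounded_elem R f"
    and f_not_invariant: "\<not> right_invariant R f"
    and f_coprime_t: "is_gcrd \<sigma> 1 f (monom 1 1)"
    and h_def: "is_min_central_left_multiple \<sigma> n f hh" "h = subst_tn n hh"
    and l_def: "num_irreducible_factors R f l"
    and k_def: "num_irreducible_factors R h k"
    and S_def: "S = petit_algebra UNIV \<sigma> f"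
    and N_def: "N = nuc S"
  shows "(irreducible_elem (poly_ring_over F) hh \<and>
            real (dim_over_fixed \<sigma> N) = real (l * n) / real k \<longrightarrow>
            nuc_right S = carrier (petit_algebra (constants_in N) \<sigma> f))
       \<and> (real (dim_over_fixed \<sigma> N) > real (n * l) / real k \<longrightarrow>
            reducible_elem (poly_ring_over F) hh \<and> reducible_elem R f)"
proof -
  interpret finite_order_automorphism \<sigma> n
    using aut order(1)
    by unfold_locales
      (auto simp: ring_iso_def ring_hom_def ring_of_type_algebra_def)
  have f_F: "f \<in> F_polys"
    using f_coeffs F_def by simp
  have f_0: "coeff f 0 \<noteq> 0"
  proof
    assume "coeff f 0 = 0"
    then have "f = poly_shift (Suc 0) f \<star> t"
      using poly_split_0[of f] by simp
    moreover have "t = 1 \<star> t"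
      by simp
    ultimately have "right_divides (skew_poly_ring UNIV \<sigma>) t f" "right_divides (skew_poly_ring UNIV \<sigma>) t t"
      unfolding right_divides_def R_simps by blast+
    then have "right_divides (skew_poly_ring UNIV \<sigma>) t 1"
      using f_coprime_t unfolding is_gcrd_def Let_def by simp
    then obtain g where "1 = g * t"
      by (auto simp: right_divides_def)
    then have "coeff 1 0 = coeff (g * t) 0"
      by (rule arg_cong)
    then show False
      by (simp add: coeff_times_t)
  qed
  have mult_iff: "right_divides (skew_poly_ring UNIV \<sigma>) f p \<longleftrightarrow> f dvd p" for p
    using f_F by (auto simp: right_divides_def dvd_def mult.commute)
  interpret min_central_multiple \<sigma> n f hh
  proof unfold_locales
    show "f \<in> F_polys" "lead_coeff f = 1" "0 < degree f" "coeff f 0 \<noteq> 0"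
      using f_F f_monic f_degree f_0 by simp_all
    show "hh \<in> F_polys" "lead_coeff hh = 1" "f dvd subst hh"
      using h_def(1) unfolding is_min_central_left_multiple_def is_central_left_multiple_def mult_iff
      by simp_all
    show "degree hh \<le> degree g" if "g \<in> F_polys" "lead_coeff g = 1" "f dvd subst g" for g
      using h_def(1) that n_pos
      unfolding is_min_central_left_multiple_def is_central_left_multiple_def mult_iff by simp
  qed
  have F: "F = fixed_field \<sigma>" and R: "R = skew_poly_ring UNIV \<sigma>"
    and S: "S = petit_algebra UNIV \<sigma> f" and N: "N = nuc (petit_algebra UNIV \<sigma> f)"
    using F_def R_def S_def N_def by simp_all
  have deg2: "degree f \<ge> 2" and not_inv: "\<not> right_invariant (skew_poly_ring UNIV \<sigma>) f"
    using f_degree f_not_invariant R by simp_all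
  have counts: "k > 0" "k * degree f = l * (n * degree hh)"
    if "irreducible_elem (poly_ring_over (fixed_field \<sigma>)) hh"
    using factor_count[OF that, of l k] l_def k_def h_def(2) R by simp_all
  let ?s = "dim_over_fixed \<sigma> N"
  have part1: "nuc_right S = carrier (petit_algebra (constants_in N) \<sigma> f)"
    if irr: "irreducible_elem (poly_ring_over F) hh" and s: "real ?s = real (l * n) / real k"
  proof -
    have irr': "irreducible_elem (poly_ring_over (fixed_field \<sigma>)) hh"
      using irr F by simp
    have "real (?s * k) = real (l * n)"
      using s counts(1)[OF irr'] by simp
    then have "?s * k = l * n"
      by (simp only: of_nat_eq_iff)
    then have "k * (?s * degree hh) = k * degree f"
      using counts(2)[OF irr'] by (metis mult.assoc mult.commute)
    then have "?s * degree hh = degree f"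
      using counts(1)[OF irr'] by simp
    then have "idealizer = {g. degree g < degree f \<and> (\<forall>i. coeff g i \<in> N_field)}"
      using nucleus_dimension(2)[OF irr' deg2 not_inv] N by simp
    moreover have "constants_in N = N_field"
      unfolding N nuc_eq[OF deg2 not_inv] by (auto simp: constants_in_def)
    ultimately show ?thesis
      unfolding S nuc_right_eq[OF deg2] by (auto simp: petit_algebra_def polys_over_iff)
  qed
  have part2: "reducible_elem (poly_ring_over F) hh \<and> reducible_elem R f"
    if s: "real ?s > real (n * l) / real k"
  proof -
    have not_irr: "\<not> irreducible_elem (poly_ring_over (fixed_field \<sigma>)) hh"
    proof
      assume irr: "irreducible_elem (poly_ring_over (fixed_field \<sigma>)) hh"
      have "real (n * l) < real (?s * k)"
        using s counts(1)[OF irr] by (simp add: field_simps)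
      then have "n * l < ?s * k"
        by (simp only: of_nat_less_iff)
      then have "n * l * degree hh < ?s * k * degree hh"
        using deg_hh_pos by simp
      also have "\<dots> \<le> k * degree f"
        using nucleus_dimension(1)[OF irr deg2 not_inv] unfolding N
        by (simp add: mult.commute mult.left_commute)
      finally show False
        using counts(2)[OF irr] by (simp add: mult.commute mult.left_commute)
    qed
    moreover have "hh \<notin> Units (poly_ring_over (fixed_field \<sigma>))"
    proof
      assume "hh \<in> Units (poly_ring_over (fixed_field \<sigma>))"
      then obtain v where "v * hh = 1"
        by (auto simp: unit_poly_ring_over_iff)
      then have "hh dvd 1"
        by (metis dvd_triv_right)
      then show False
        using deg_hh_pos dvd_imp_degree_le[of hh 1] by simp
    qed
    moreover have "f \<notin> Units (skew_poly_ring UNIV \<sigma>)"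
    proof
      assume "f \<in> Units (skew_poly_ring UNIV \<sigma>)"
      then obtain v where "v \<star> f = 1"
        by (auto simp: Units_def)
      then have "f dvd 1"
        by (metis dvd_triv_right skew_F_poly f_F)
      then show False
        using deg2 dvd_imp_degree_le[of f 1] by simp
    qed
    moreover have "\<not> irreducible_elem (skew_poly_ring UNIV \<sigma>) f"
      using irreducible_imp_irreducible_hh not_irr by blast
    ultimately show ?thesis
      unfolding reducible_elem_def F R using hh_F by simp
  qed
  from part1 part2 show ?thesis
    by blast
qed

end
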